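(* Let $X^*\in\mathbb{R}^{m_1\times m_2}$ satisfy $\|X^*\|_\infty\le\gamma$ and let $r=\operatorname{rank}(X^* )$, so that $X^*\in K_{\max}(\gamma,r)$. Let $\hat X^{(2)}$ be the max-norm constrained maximum likelihood estimator $$\hat X^{(2)}\in\arg\max_{X\in K_{\max}(\gamma,r)}\ell_{\Omega,Y}(X),$$ and let $\hat\eta(\omega)=\operatorname{sign}(\hat X^{(2)}_\omega)$ be the associated plug-in classifier. Then $$\mathrm{excess}(\hat\eta,\eta^* )\le\sqrt{C_\gamma\sqrt{\frac{\operatorname{rank}(X^* )\,d}{n}}},$$ where $C_\gamma>0$ is a constant depending only on $\gamma$.
   Context: Setup (1-bit matrix completion with logistic link). Let $m_1,m_2\ge1$, $d=m_1+m_2$, and let $f(x)=e^x/(1+e^x)$. An unknown matrix $X^*\in\mathbb{R}^{m_1\times m_2}$ is given. Indices $\omega_1,\dots,\omega_n$ are i.i.d. uniform on $[m_1]\times[m_2]$ (where $[k]=\{1,\dots,k\}$), $\Omega=(\omega_i)_{i=1}^n$, and, conditionally on the indices, the labels $Y_1,\dots,Y_n\in\{-1,1\}$ are independent with $Y_i=+1$ with probability $f(X^*_{\omega_i})$ and $Y_i=-1$ with probability $1-f(X^*_{\omega_i})$. The sample is $\mathcal S=\{(Y_i,\omega_i)\}_{i=1}^n$. Log-likelihood: $\ell_{\Omega,Y}(X)=\sum_{i=1}^n\big(\mathbf 1\{Y_i=1\}\log f(X_{\omega_i})+\mathbf 1\{Y_i=-1\}\log(1-f(X_{\omega_i}))\big)$.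 Norms: $\|X\|_\infty=\max_{i,j}|X_{ij}|$; $\|U\|_{2,\infty}$ is the maximum Euclidean norm of the rows of $U$; the max-norm is $\|X\|_{\max}=\min_{X=UV^\top}\|U\|_{2,\infty}\|V\|_{2,\infty}$. For $\gamma,r>0$, $K_{\max}(\gamma,r)=\{X\in\mathbb{R}^{m_1\times m_2}:\|X\|_\infty\le\gamma,\ \|X\|_{\max}\le\gamma\sqrt r\}$. Classification risk: for a (possibly data-dependent) classifier $\eta:[m_1]\times[m_2]\to\{-1,1\}$, let $(Y,\omega)$ be a new pair independent of $\mathcal S$ with $\omega$ uniform on $[m_1]\times[m_2]$ and $Y\mid\omega$ equal to $+1$ with probability $f(X^*_\omega)$ and $-1$ otherwise; $R(\eta)=\mathbb P(Y\ne\eta(\omega)\mid\mathcal S)$. The Bayes classifier is $\eta^*(\omega)=\operatorname{sign}(X^*_\omega)$ (i.e. $+1$ iff $f(X^*_\omega)\ge1/2$, with $\operatorname{sign}(0)=+1$), which minimizes $R$. For an estimator $\hat X$ the plug-in classifier is $\hat\eta(\omega)=\operatorname{sign}(\hat X_\omega)$ and the misclassification excess risk is $\mathrm{excess}(\hat\eta,\eta^* )=\mathbb E\,R(\hat\eta)-R(\eta^* )$, the expectation being over $\mathcal S$. *)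

theory Defs
  imports "HOL-Probability.Probability" "Jordan_Normal_Form.DL_Rank"
begin

text \<open>Matrices are Jordan_Normal_Form matrices; indices are 0-based, so the index set
  [m1] x [m2] is rendered as {..<m1} x {..<m2}. Labels: True stands for +1, False for -1.\<close>

definition logistic :: "real \<Rightarrow> real" where
  "logistic x = exp x / (1 + exp x)"

definition sup_norm :: "real mat \<Rightarrow> real" where
  "sup_norm X = (MAX ij \<in> {..<dim_row X} \<times> {..<dim_col X}. \<bar>X $$ ij\<bar>)"

definition two_inf_norm :: "real mat \<Rightarrow> real" where
  "two_inf_norm U = (MAX i \<in> {..<dim_row U}. sqrt (\<Sum>j<dim_col U. (U $$ (i, j))^2))"

definition max_norm :: "real mat \<Rightarrow> real" where
  "max_norm X = Inf {two_inf_norm U * two_inf_norm V | U V k.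
      U \<in> carrier_mat (dim_row X) k \<and> V \<in> carrier_mat (dim_col X) k \<and> X = U * V\<^sup>T}"

definition K_max :: "nat \<Rightarrow> nat \<Rightarrow> real \<Rightarrow> real \<Rightarrow> real mat set" where
  "K_max m1 m2 \<gamma> r = {X \<in> carrier_mat m1 m2. sup_norm X \<le> \<gamma> \<and> max_norm X \<le> \<gamma> * sqrt r}"

definition draw_pmf :: "real mat \<Rightarrow> (bool \<times> (nat \<times> nat)) pmf" where
  "draw_pmf X = do {
     \<omega> \<leftarrow> pmf_of_set ({..<dim_row X} \<times> {..<dim_col X});
     y \<leftarrow> bernoulli_pmf (logistic (X $$ \<omega>));
     return_pmf (y, \<omega>) }"

definition sample_pmf :: "nat \<Rightarrow> real mat \<Rightarrow> (nat \<Rightarrow> bool \<times> (nat \<times> nat)) pmf" where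
  "sample_pmf n X = Pi_pmf {..<n} (True, (0, 0)) (\<lambda>_. draw_pmf X)"

definition loglik :: "nat \<Rightarrow> (nat \<Rightarrow> bool \<times> (nat \<times> nat)) \<Rightarrow> real mat \<Rightarrow> real" where
  "loglik n S X = (\<Sum>i<n. (if fst (S i) then ln (logistic (X $$ snd (S i)))
                          else ln (1 - logistic (X $$ snd (S i)))))"

definition risk :: "real mat \<Rightarrow> (nat \<times> nat \<Rightarrow> bool) \<Rightarrow> real" where
  "risk X \<eta> = measure_pmf.prob (draw_pmf X) {(y, \<omega>). y \<noteq> \<eta> \<omega>}"

text \<open>plug-in classifier sign(Z_omega), with sign 0 = +1\<close>
definition plugin :: "real mat \<Rightarrow> nat \<times> nat \<Rightarrow> bool" where
  "plugin Z \<omega> = (Z $$ \<omega> \<ge> 0)"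

definition excess_risk ::
  "nat \<Rightarrow> real mat \<Rightarrow> ((nat \<Rightarrow> bool \<times> (nat \<times> nat)) \<Rightarrow> real mat) \<Rightarrow> real" where
  "excess_risk n X Xhat =
     measure_pmf.expectation (sample_pmf n X) (\<lambda>S. risk X (plugin (Xhat S))) - risk X (plugin X)"

end

theory Submission
  imports Defs
begin

text \<open>
  The estimator competes with the true matrix \<open>X\<close>, so \<open>X\<close> must lie in the constraint set, i.e.
  its max-norm is at most \<open>\<gamma> * sqrt (rank X)\<close>. Write \<open>X = A * B\<^sup>T\<close> with \<open>A\<close> of full column rank and
  take a D-optimal design \<open>p\<close> for the rows of \<open>A\<close>, with information matrix \<open>M\<close>. Factoring
  \<open>X\<close> through \<open>M\<close> gives a left factor whose squared row norms are the leverages, at most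
  \<open>rank X\<close>, and a right factor whose squared row norms are \<open>p\<close>-averages of squared entries of \<open>X\<close>.

  Comparing likelihoods, the expected Kullback--Leibler risk is at most the expected supremum over
  the constraint set of the centered empirical log-loss. Symmetrization and the contraction
  principle (the log-loss is 1-Lipschitz) replace it by the supremum of
  \<open>\<Sum>i. \<epsilon>\<^sub>i * Z\<^sub>\<omega>\<^sub>i\<close>. Grothendieck's inequality bounds this by a multiple of the maximum over
  the \<open>2 ^ (m1 + m2)\<close> pairs of sign vectors, and Massart's exponential moment argument gives the rate
  \<open>\<gamma> * sqrt (rank X * (m1 + m2) / n)\<close>.

  Where the plug-in rule errs, \<open>logistic X\<^sub>\<omega>\<close> and \<open>logistic Z\<^sub>\<omega>\<close> lie on different sides of \<open>1/2\<close>, so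
  the excess risk is at most twice their mean distance. Pinsker's inequality and AM-GM turn this into
  the square root of the Kullback--Leibler risk.
\<close>

section \<open>Max-norm and rank\<close>

text \<open>The columns of \<open>A\<close> form a maximal independent set of columns of
  \<open>X\<close>, and \<open>B\<close> holds the coordinates of all columns of \<open>X\<close> in
  that basis. Injectivity of \<open>A\<close> later makes its information matrix invertible.\<close>

lemma (in vec_space) rank_factorization:
  assumes X: "X \<in> carrier_mat n nc"
  obtains A B where "A \<in> carrier_mat n (rank X)" "B \<in> carrier_mat nc (rank X)" "X = A * B\<^sup>T"
    "\<And>v. v \<in> carrier_vec (rank X) \<Longrightarrow> A *\<^sub>v v = 0\<^sub>v n \<Longrightarrow> v = 0\<^sub>v (rank X)"
proof -
  define P where "P = (\<lambda>T. T \<subseteq> set (cols X) \<and> lin_indpt T)"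
  have "lin_indpt {}" by (simp add: lin_dep_def)
  then have "P {}" by (simp add: P_def)
  then obtain S where finS: "finite S" and max: "maximal S P"
    using maximal_exists_superset[of "set (cols X)" P "{}"] by (auto simp: P_def)
  have r: "rank X = card S" using rank_card_indpt[OF X] max unfolding P_def by blast
  have PS: "P S" using max by (simp add: maximal_def)
  have cX: "set (cols X) \<subseteq> carrier_vec n" using cols_dim X by blast
  have Sc: "S \<subseteq> carrier_vec n" using PS cX P_def by blast
  obtain ss where ss: "set ss = S" "distinct ss" using finite_distinct_list[OF finS] by blast
  define A where "A = mat_of_cols n ss"
  have len: "length ss = rank X" using ss r distinct_card by fastforce
  have A: "A \<in> carrier_mat n (rank X)" using len by (auto simp: A_def)
  have colsA: "cols A = ss" using Sc ss(1) by (simp add: A_def)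
  have span: "v \<in> span S" if v: "v \<in> set (cols X)" for v
  proof (cases "v \<in> S")
    case True
    then show ?thesis using Sc by (simp add: span_mem)
  next
    case False
    have "\<not> P (insert v S)" using max False unfolding maximal_def by blast
    then have dep: "lin_dep (insert v S)" using v PS by (simp add: P_def)
    then show ?thesis
      using lin_dep_iff_in_span[of S v] PS Sc v cX False by (auto simp: P_def)
  qed
  have "\<exists>b. b \<in> carrier_vec (rank X) \<and> A *\<^sub>v b = col X j" if j: "j < nc" for j
  proof -
    have "col X j \<in> set (cols X)" using j X by (auto simp: cols_def)
    then have "col X j \<in> span S" by (rule span)
    then obtain a where "lincomb a S = col X j" using finS Sc in_spanE
      using finite_in_span by metis
    then have "A *\<^sub>v vec (rank X) (\<lambda>i. a (col A i)) = col X j"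
      using mat_mult_eq_lincomb[OF A, of a] ss colsA by simp
    then show ?thesis by (metis vec_carrier)
  qed
  then obtain b where b: "\<And>j. j < nc \<Longrightarrow> b j \<in> carrier_vec (rank X)"
    "\<And>j. j < nc \<Longrightarrow> A *\<^sub>v b j = col X j" by metis
  define B where "B = mat nc (rank X) (\<lambda>(j, i). b j $ i)"
  have B: "B \<in> carrier_mat nc (rank X)" by (simp add: B_def)
  have "X = A * B\<^sup>T"
  proof (rule eq_matI)
    fix i j assume "i < dim_row (A * B\<^sup>T)" "j < dim_col (A * B\<^sup>T)"
    then have ij: "i < n" "j < nc" using A B by auto
    have "col (B\<^sup>T) j = b j" using b(1)[OF ij(2)] ij by (auto simp: B_def)
    then have "(A * B\<^sup>T) $$ (i,j) = row A i \<bullet> b j" using ij A B by simp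
    also have "\<dots> = (A *\<^sub>v b j) $ i" using ij A by simp
    also have "\<dots> = X $$ (i,j)" using b(2)[OF ij(2)] ij X by simp
    finally show "X $$ (i,j) = (A * B\<^sup>T) $$ (i,j)" ..
  qed (use X A B in auto)
  moreover have "v = 0\<^sub>v (rank X)" if "v \<in> carrier_vec (rank X)" "A *\<^sub>v v = 0\<^sub>v n" for v
    using lin_depI[OF A that(1) _ that(2)] ss colsA PS by (auto simp: P_def)
  ultimately show thesis using that A B by blast
qed

text \<open>The matrix determinant lemma. Both sides compute the determinant of the bordered matrix
  \<open>P\<close>: the unitriangular \<open>E1\<close> clears its lower left block,
  \<open>E2\<close> its upper right block.\<close>

lemma det_rank_one_update:
  fixes M :: "real mat"
  assumes M: "M \<in> carrier_mat r r" and a: "a \<in> carrier_mat r 1"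
    and N: "N \<in> carrier_mat r r" "M * N = 1\<^sub>m r"
  shows "det (M + s \<cdot>\<^sub>m (a * a\<^sup>T)) = det M * (1 + s * (a\<^sup>T * N * a) $$ (0,0))"
proof -
  define P where "P = four_block_mat M ((-s) \<cdot>\<^sub>m a) (a\<^sup>T) (1\<^sub>m 1)"
  define E1 where "E1 = four_block_mat (1\<^sub>m r) (0\<^sub>m r 1) (- a\<^sup>T) (1\<^sub>m 1)"
  define E2 where "E2 = four_block_mat (1\<^sub>m r) (s \<cdot>\<^sub>m (N * a)) (0\<^sub>m 1 r) (1\<^sub>m 1)"
  have c: "P \<in> carrier_mat (r+1) (r+1)" "E1 \<in> carrier_mat (r+1) (r+1)" "E2 \<in> carrier_mat (r+1) (r+1)"
    using M a N by (auto simp: P_def E1_def E2_def)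
  have d1: "det E1 = 1" unfolding E1_def
    by (subst det_four_block_mat_upper_right_zero[of _ r _ 1]) (use a in auto)
  have d2: "det E2 = 1" unfolding E2_def
    by (subst det_four_block_mat_lower_left_zero[of _ r _ 1]) (use a N in auto)
  have "P * E1 = four_block_mat (M + s \<cdot>\<^sub>m (a * a\<^sup>T)) ((-s) \<cdot>\<^sub>m a) (0\<^sub>m 1 r) (1\<^sub>m 1)"
    unfolding P_def E1_def
    by (subst mult_four_block_mat[of _ r r _ 1 _ 1 _ _ r _ 1])
      (use M a in \<open>auto intro!: arg_cong2[where f="\<lambda>x y. four_block_mat x ((-s) \<cdot>\<^sub>m a) y (1\<^sub>m 1)"] eq_matI\<close>)
  then have e1: "det P = det (M + s \<cdot>\<^sub>m (a * a\<^sup>T))"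
    using det_mult[OF c(1,2)] d1
    by (simp, subst (asm) det_four_block_mat_lower_left_zero[of _ r _ 1]) (use M a in auto)
  have MNa: "M * (s \<cdot>\<^sub>m (N * a)) = s \<cdot>\<^sub>m a"
  proof -
    have "M * (s \<cdot>\<^sub>m (N * a)) = s \<cdot>\<^sub>m (M * (N * a))"
      using M N a by (intro mult_smult_distrib) auto
    also have "M * (N * a) = M * N * a" using M N a by (intro assoc_mult_mat[symmetric]) auto
    finally show ?thesis using N a by simp
  qed
  have "P * E2 = four_block_mat M (0\<^sub>m r 1) (a\<^sup>T) (s \<cdot>\<^sub>m (a\<^sup>T * N * a) + 1\<^sub>m 1)"
    unfolding P_def E2_def
    by (subst mult_four_block_mat[of _ r r _ 1 _ 1 _ _ r _ 1]) (use M a N in \<open>auto simp: MNa\<close>)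
  then have "det P = det M * det (s \<cdot>\<^sub>m (a\<^sup>T * N * a) + 1\<^sub>m 1)"
    using det_mult[OF c(1,3)] d2
    by (simp, subst (asm) det_four_block_mat_upper_right_zero[of _ r _ 1]) (use M a N in auto)
  also have "det (s \<cdot>\<^sub>m (a\<^sup>T * N * a) + 1\<^sub>m 1) = 1 + s * (a\<^sup>T * N * a) $$ (0,0)"
    by (subst det_single) (use a N in auto)
  finally show ?thesis using e1 by simp
qed

text \<open>Both sides equal 1 at \<open>s = 0\<close>, so the inequality passes to the right
  derivatives there, which are \<open>q\<close> and \<open>r\<close>.\<close>

lemma bounded_growth_imp_le:
  fixes q :: real and r :: nat
  assumes "\<And>s. s > 0 \<Longrightarrow> 1 + s * q \<le> (1 + s) ^ r"
  shows "q \<le> r"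
proof -
  have "((\<lambda>s::real. (1+s)^r) has_real_derivative r) (at 0)"
    by (auto intro!: derivative_eq_intros)
  then have "((\<lambda>h. ((1+h)^r - 1) / h) \<longlongrightarrow> real r) (at_right 0)"
    by (auto simp: DERIV_def filterlim_at_split)
  moreover have "\<forall>\<^sub>F h in at_right 0. q \<le> ((1+h)^r - 1) / h"
    unfolding eventually_at_right_field
    by (rule exI[of _ 1]) (use assms in \<open>auto simp: field_simps\<close>)
  ultimately show ?thesis by (rule tendsto_lowerbound) simp
qed


section \<open>D-optimal designs and their information matrices\<close>

definition design_mat :: "real mat \<Rightarrow> (nat \<Rightarrow> real) \<Rightarrow> real mat" where
  "design_mat A p = mat (dim_col A) (dim_col A) (\<lambda>(k, l). \<Sum>i<dim_row A. p i * A $$ (i, k) * A $$ (i, l))"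

definition sqrt_design :: "real mat \<Rightarrow> (nat \<Rightarrow> real) \<Rightarrow> real mat" where
  "sqrt_design A p = mat (dim_row A) (dim_col A) (\<lambda>(i, k). sqrt (p i) * A $$ (i, k))"

lemma design_mat_eq_gram:
  assumes "\<And>i. i < dim_row A \<Longrightarrow> p i \<ge> 0"
  shows "design_mat A p = (sqrt_design A p)\<^sup>T * sqrt_design A p"
proof (rule eq_matI)
  fix k l assume "k < dim_row ((sqrt_design A p)\<^sup>T * sqrt_design A p)"
    "l < dim_col ((sqrt_design A p)\<^sup>T * sqrt_design A p)"
  then have kl: "k < dim_col A" "l < dim_col A" by (auto simp: sqrt_design_def)
  then have "((sqrt_design A p)\<^sup>T * sqrt_design A p) $$ (k, l) =
      (\<Sum>i<dim_row A. (sqrt (p i) * A $$ (i, k)) * (sqrt (p i) * A $$ (i, l)))"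
    by (simp add: sqrt_design_def scalar_prod_def lessThan_atLeast0)
  also have "\<dots> = (\<Sum>i<dim_row A. p i * A $$ (i, k) * A $$ (i, l))"
  proof (rule sum.cong)
    fix i assume "i \<in> {..<dim_row A}"
    then have "sqrt (p i) * sqrt (p i) = p i" using assms by simp
    then show "(sqrt (p i) * A $$ (i, k)) * (sqrt (p i) * A $$ (i, l)) = p i * A $$ (i, k) * A $$ (i, l)"
      by (metis mult.assoc mult.left_commute)
  qed simp
  finally show "design_mat A p $$ (k, l) = ((sqrt_design A p)\<^sup>T * sqrt_design A p) $$ (k, l)"
    using kl by (simp add: design_mat_def)
qed (auto simp: design_mat_def sqrt_design_def)

text \<open>For \<open>v\<close> in the kernel of the Gram matrix, the squared length of
  \<open>S *\<^sub>v v\<close> is zero, so \<open>v\<close> is in the kernel of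
  \<open>S\<close>.\<close>

lemma det_gram_nonzero:
  fixes S :: "real mat"
  assumes S: "S \<in> carrier_mat m r"
    and inj: "\<And>v. v \<in> carrier_vec r \<Longrightarrow> S *\<^sub>v v = 0\<^sub>v m \<Longrightarrow> v = 0\<^sub>v r"
  shows "det (S\<^sup>T * S) \<noteq> 0"
proof
  assume "det (S\<^sup>T * S) = 0"
  moreover have "S\<^sup>T * S \<in> carrier_mat r r" using S by auto
  ultimately obtain v where v: "v \<in> carrier_vec r" "v \<noteq> 0\<^sub>v r" "(S\<^sup>T * S) *\<^sub>v v = 0\<^sub>v r"
    using det_0_iff_vec_prod_zero_field by blast
  have Sv: "S *\<^sub>v v \<in> carrier_vec m" using S v by auto
  have "S\<^sup>T *\<^sub>v (S *\<^sub>v v) = 0\<^sub>v r"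
    using v S by (metis assoc_mult_mat_vec transpose_carrier_mat)
  then have "(S\<^sup>T *\<^sub>v (S *\<^sub>v v)) \<bullet> v = 0" using v by simp
  then have "(S *\<^sub>v v) \<bullet> (S *\<^sub>v v) = 0"
    using transpose_vec_mult_scalar[OF S v(1) Sv] by simp
  then have "(\<Sum>i = 0..<m. ((S *\<^sub>v v) $ i)^2) = 0"
    using S by (simp add: scalar_prod_def power2_eq_square)
  then have "\<forall>i\<in>{0..<m}. ((S *\<^sub>v v) $ i)^2 = 0" by (subst (asm) sum_nonneg_eq_0_iff) auto
  then have "S *\<^sub>v v = 0\<^sub>v m" using S by (intro eq_vecI) auto
  then show False using inj v by blast
qed

text \<open>The Leibniz expansion is a polynomial in finitely many coordinates of \<open>p\<close>.
  Together with compactness of the simplex, this yields an optimal design.\<close>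

lemma continuous_on_det_design_mat: "continuous_on UNIV (\<lambda>p. det (design_mat A p))"
proof -
  have "(\<lambda>p. det (design_mat A p)) = (\<lambda>p. \<Sum>\<sigma> | \<sigma> permutes {0..<dim_col A}. signof \<sigma> *
     (\<Prod>k = 0..<dim_col A. \<Sum>i<dim_row A. p i * A $$ (i, k) * A $$ (i, \<sigma> k)))"
  proof
    fix p
    show "det (design_mat A p) = (\<Sum>\<sigma> | \<sigma> permutes {0..<dim_col A}. signof \<sigma> *
     (\<Prod>k = 0..<dim_col A. \<Sum>i<dim_row A. p i * A $$ (i, k) * A $$ (i, \<sigma> k)))"
      by (subst det_def'[of _ "dim_col A"])
        (auto simp: design_mat_def permutes_in_image[of _ "{0..<dim_col A}", unfolded atLeastLessThan_iff, simplified]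
          intro!: sum.cong prod.cong)
  qed
  then show ?thesis
    by (simp only:) (intro continuous_intros continuous_on_product_coordinates)
qed

text \<open>Weights are total functions on the naturals; pinning the coordinates from
  \<open>m\<close> on to 0 makes the simplex a closed subset of a product of compact sets.\<close>

lemma compact_simplex:
  "compact {p :: nat \<Rightarrow> real. (\<forall>i. p i \<in> (if i < m then {0..1} else {0})) \<and> (\<Sum>i<m. p i) = 1}"
proof -
  have "compactin (product_topology (\<lambda>i. euclidean) UNIV)
     (PiE UNIV (\<lambda>i::nat. if i < m then {0..1::real} else {0}))"
    by (subst compactin_PiE) auto
  then have "compact (PiE UNIV (\<lambda>i::nat. if i < m then {0..1::real} else {0}))"
    by (simp add: euclidean_product_topology)
  moreover have "closed {p :: nat \<Rightarrow> real. (\<Sum>i<m. p i) = 1}"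
    by (intro closed_Collect_eq continuous_intros continuous_on_product_coordinates)
  ultimately have "compact (PiE UNIV (\<lambda>i::nat. if i < m then {0..1::real} else {0}) \<inter> {p. (\<Sum>i<m. p i) = 1})"
    by (rule compact_Int_closed)
  also have "PiE UNIV (\<lambda>i::nat. if i < m then {0..1::real} else {0}) \<inter> {p. (\<Sum>i<m. p i) = 1} =
    {p :: nat \<Rightarrow> real. (\<forall>i. p i \<in> (if i < m then {0..1} else {0})) \<and> (\<Sum>i<m. p i) = 1}"
    by (auto simp: PiE_def Pi_def)
  finally show ?thesis .
qed

text \<open>The Kiefer--Wolfowitz theorem on D-optimal designs. At a maximiser of \<open>\<bar>det\<bar>\<close>, moving a mass \<open>s\<close>
  towards the \<open>i\<close>-th row multiplies the determinant by \<open>(1 + s * q) / (1 + s) ^ r\<close>, where \<open>q\<close> is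
  the \<open>i\<close>-th leverage; hence \<open>q \<le> r\<close>.\<close>

lemma optimal_design:
  assumes A: "A \<in> carrier_mat m r" and m: "m \<ge> 1"
    and inj: "\<And>v. v \<in> carrier_vec r \<Longrightarrow> A *\<^sub>v v = 0\<^sub>v m \<Longrightarrow> v = 0\<^sub>v r"
  obtains p N where "\<And>i. i < m \<Longrightarrow> p i \<ge> 0" "(\<Sum>i<m. p i) = 1" "N \<in> carrier_mat r r"
    "design_mat A p * N = 1\<^sub>m r" "N * design_mat A p = 1\<^sub>m r" "\<And>i. i < m \<Longrightarrow> (A * N * A\<^sup>T) $$ (i, i) \<le> r"
proof -
  define P where "P = {p :: nat \<Rightarrow> real. (\<forall>i. p i \<in> (if i < m then {0..1} else {0})) \<and> (\<Sum>i<m. p i) = 1}"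
  define F where "F p = \<bar>det (design_mat A p)\<bar>" for p
  define u where "u i = (if i < m then 1 / real m else 0)" for i
  have u: "u \<in> P" using m by (auto simp: P_def u_def)
  have "continuous_on P F" unfolding F_def
    by (intro continuous_intros continuous_on_subset[OF continuous_on_det_design_mat]) auto
  then obtain p where p: "p \<in> P" and max: "\<And>q. q \<in> P \<Longrightarrow> F q \<le> F p"
    using continuous_attains_sup[of P F] compact_simplex[of m] u unfolding P_def by blast
  have p0: "p i \<ge> 0" if "i < m" for i using p that by (auto simp: P_def dest: spec[of _ i])
  have p1: "(\<Sum>i<m. p i) = 1" using p by (simp add: P_def)
  have W: "design_mat A q \<in> carrier_mat r r" for q using A by (simp add: design_mat_def)
  \<comment> \<open>The uniform design already has an invertible information matrix, so the maximum
    of \<open>F\<close> is positive.\<close>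
  have "det (design_mat A u) \<noteq> 0"
  proof (subst design_mat_eq_gram)
    show "det ((sqrt_design A u)\<^sup>T * sqrt_design A u) \<noteq> 0"
    proof (rule det_gram_nonzero)
      show "sqrt_design A u \<in> carrier_mat m r" using A by (simp add: sqrt_design_def)
      fix v assume v: "v \<in> carrier_vec r" "sqrt_design A u *\<^sub>v v = 0\<^sub>v m"
      have "(sqrt_design A u *\<^sub>v v) $ i = sqrt (1 / m) * (A *\<^sub>v v) $ i" if "i < m" for i
        using that v(1) A by (simp add: sqrt_design_def u_def scalar_prod_def sum_distrib_left mult_ac)
      then have "(A *\<^sub>v v) $ i = 0" if "i < m" for i using that v m by simp
      then have "A *\<^sub>v v = 0\<^sub>v m" using A m by (intro eq_vecI) auto
      then show "v = 0\<^sub>v r" using inj v by blast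
    qed
  qed (auto simp: u_def)
  then have Fp: "F p > 0" using max[OF u] by (simp add: F_def)
  then have "det (design_mat A p) \<noteq> 0" by (simp add: F_def)
  then obtain N where N: "N \<in> carrier_mat r r" "design_mat A p * N = 1\<^sub>m r" "N * design_mat A p = 1\<^sub>m r"
    using det_non_zero_imp_unit[OF W, of p "()"] by (auto simp: Units_def ring_mat_def)
  have "(A * N * A\<^sup>T) $$ (i, i) \<le> r" if i: "i < m" for i
  proof (rule bounded_growth_imp_le)
    fix s :: real assume s: "s > 0"
    define a where "a = mat r 1 (\<lambda>(k, _). A $$ (i, k))"
    have a: "a \<in> carrier_mat r 1" by (simp add: a_def)
    \<comment> \<open>The design \<open>p\<close> with extra mass \<open>s\<close> on row
      \<open>i\<close>, renormalised by the new total mass \<open>1 + s\<close>.\<close>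
    define q where "q j = (if j < m then (p j + (if j = i then s else 0)) / (1 + s) else 0)" for j
    have qsum: "(\<Sum>j<m. q j) = 1"
      using p1 i s by (simp add: q_def sum_divide_distrib[symmetric] sum.distrib)
    have q0: "q j \<ge> 0" for j using p0 s by (simp add: q_def)
    have "q j \<le> 1" for j
    proof (cases "j < m")
      case True
      then show ?thesis using qsum q0 member_le_sum[of j "{..<m}" q] by simp
    qed (simp add: q_def)
    moreover have "q j = 0" if "\<not> j < m" for j using that by (simp add: q_def)
    ultimately have qP: "q \<in> P" using qsum q0 by (simp add: P_def)
    have "design_mat A p + s \<cdot>\<^sub>m (a * a\<^sup>T) = (1 + s) \<cdot>\<^sub>m design_mat A q"
    proof (rule eq_matI)
      fix k l assume "k < dim_row ((1 + s) \<cdot>\<^sub>m design_mat A q)" "l < dim_col ((1 + s) \<cdot>\<^sub>m design_mat A q)"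
      then have kl: "k < r" "l < r" using W[of q] by auto
      have "((1 + s) \<cdot>\<^sub>m design_mat A q) $$ (k, l) = (\<Sum>j<m. ((1 + s) * q j) * A $$ (j, k) * A $$ (j, l))"
        using kl A by (simp add: design_mat_def sum_distrib_left mult_ac)
      also have "\<dots> = (\<Sum>j<m. p j * A $$ (j, k) * A $$ (j, l) + (if j = i then s * A $$ (i, k) * A $$ (i, l) else 0))"
      proof (rule sum.cong)
        fix j assume "j \<in> {..<m}"
        then have "(1 + s) * q j = p j + (if j = i then s else 0)" using s by (simp add: q_def)
        then show "((1 + s) * q j) * A $$ (j, k) * A $$ (j, l) =
            p j * A $$ (j, k) * A $$ (j, l) + (if j = i then s * A $$ (i, k) * A $$ (i, l) else 0)"
          by (simp only: distrib_right) auto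
      qed simp
      also have "\<dots> = (\<Sum>j<m. p j * A $$ (j, k) * A $$ (j, l)) + s * A $$ (i, k) * A $$ (i, l)"
        using i by (simp add: sum.distrib)
      also have "\<dots> = (design_mat A p + s \<cdot>\<^sub>m (a * a\<^sup>T)) $$ (k, l)"
        using kl A by (simp add: design_mat_def a_def scalar_prod_def)
      finally show "(design_mat A p + s \<cdot>\<^sub>m (a * a\<^sup>T)) $$ (k, l) = ((1 + s) \<cdot>\<^sub>m design_mat A q) $$ (k, l)" ..
    qed (use A a in \<open>auto simp: design_mat_def\<close>)
    then have "(1 + s) ^ r * det (design_mat A q) = det (design_mat A p) * (1 + s * (a\<^sup>T * N * a) $$ (0,0))"
      using det_rank_one_update[OF W a N(1,2), of s] W[of q] by simp
    moreover have "(a\<^sup>T * N * a) $$ (0,0) = (A * N * A\<^sup>T) $$ (i, i)"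
    proof -
      have "row (a\<^sup>T) 0 = row A i" "col a 0 = col (A\<^sup>T) i"
        using A i by (auto simp: a_def row_def)
      moreover have "row (a\<^sup>T * N) 0 = row (A * N) i"
        using A N a i \<open>row (a\<^sup>T) 0 = row A i\<close> by (intro eq_vecI) auto
      ultimately show ?thesis using A N a i by simp
    qed
    ultimately have "\<bar>(1 + s) ^ r * det (design_mat A q)\<bar> =
        \<bar>det (design_mat A p) * (1 + s * (A * N * A\<^sup>T) $$ (i, i))\<bar>" by (simp only:)
    then have "F p * \<bar>1 + s * (A * N * A\<^sup>T) $$ (i, i)\<bar> = (1 + s) ^ r * F q"
      using s by (simp only: F_def abs_mult) simp
    also have "\<dots> \<le> (1 + s) ^ r * F p" using max[OF qP] s by (intro mult_left_mono) auto
    finally have "\<bar>1 + s * (A * N * A\<^sup>T) $$ (i, i)\<bar> \<le> (1 + s) ^ r" using Fp by (simp add: mult.commute)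
    then show "1 + s * (A * N * A\<^sup>T) $$ (i, i) \<le> (1 + s) ^ r" by linarith
  qed
  then show thesis using that[OF p0 p1 N] by blast
qed

section \<open>Row norms, factorizations and the max-norm\<close>

lemma two_inf_norm_nonneg: "dim_row U > 0 \<Longrightarrow> two_inf_norm U \<ge> 0"
  unfolding two_inf_norm_def
  by (rule order_trans[OF _ Max_ge[OF _ imageI[of 0]]]) (auto intro: sum_nonneg)

lemma two_inf_norm_leI:
  assumes "dim_row U > 0" "\<And>i. i < dim_row U \<Longrightarrow> (\<Sum>j<dim_col U. (U $$ (i, j))^2) \<le> c^2" "c \<ge> 0"
  shows "two_inf_norm U \<le> c"
  unfolding two_inf_norm_def
proof (rule Max.boundedI)
  fix x assume "x \<in> (\<lambda>i. sqrt (\<Sum>j<dim_col U. (U $$ (i, j))^2)) ` {..<dim_row U}"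
  then obtain i where "i < dim_row U" "x = sqrt (\<Sum>j<dim_col U. (U $$ (i, j))^2)" by blast
  then show "x \<le> c" using assms(2)[of i] assms(3) by (simp add: real_le_lsqrt)
qed (use assms(1) in auto)

lemma sum_row_sq_eq_gram:
  assumes "(U :: real mat) \<in> carrier_mat m k" "i < m"
  shows "(\<Sum>j<dim_col U. (U $$ (i, j))^2) = (U * U\<^sup>T) $$ (i, i)"
proof -
  have "(U * U\<^sup>T) $$ (i, i) = (\<Sum>j = 0..<k. U $$ (i, j) * U $$ (i, j))"
    using assms by (simp add: scalar_prod_def)
  then show ?thesis using assms by (simp add: power2_eq_square lessThan_atLeast0)
qed

lemma abs_index_le_sup_norm:
  assumes "i < dim_row X" "j < dim_col X"
  shows "\<bar>X $$ (i, j)\<bar> \<le> sup_norm X"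
  unfolding sup_norm_def using assms by (intro Max_ge imageI[of "(i, j)"]) auto

text \<open>A member of a set of reals bounds its infimum only if the set is bounded below; here 0
  is a lower bound because both factors have at least one row.\<close>

lemma max_norm_le_mult:
  assumes "dim_row X > 0" "dim_col X > 0"
    and "U \<in> carrier_mat (dim_row X) k" "V \<in> carrier_mat (dim_col X) k" "X = U * V\<^sup>T"
  shows "max_norm X \<le> two_inf_norm U * two_inf_norm V"
  unfolding max_norm_def
proof (rule cInf_lower)
  show "bdd_below {two_inf_norm U * two_inf_norm V | U V k.
      U \<in> carrier_mat (dim_row X) k \<and> V \<in> carrier_mat (dim_col X) k \<and> X = U * V\<^sup>T}"
  proof (rule bdd_belowI[of _ 0])
    fix x assume "x \<in> {two_inf_norm U * two_inf_norm V | U V k.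
      U \<in> carrier_mat (dim_row X) k \<and> V \<in> carrier_mat (dim_col X) k \<and> X = U * V\<^sup>T}"
    then obtain U V k where x: "x = two_inf_norm U * two_inf_norm V"
      and "U \<in> carrier_mat (dim_row X) k" "V \<in> carrier_mat (dim_col X) k" by blast
    then show "0 \<le> x" unfolding x
      using assms(1,2) by (intro mult_nonneg_nonneg two_inf_norm_nonneg) (simp_all only: carrier_matD)
  qed
qed (use assms in blast)

text \<open>Puts the true matrix into the constraint set. Inserting the identity
  \<open>N * (S\<^sup>T * S)\<close> between \<open>A\<close> and \<open>B\<^sup>T\<close> splits
  \<open>X\<close> into two factors whose rows are controlled by the optimal design.\<close>

lemma max_norm_le_sqrt_rank:
  assumes X: "X \<in> carrier_mat m1 m2" and m: "m1 \<ge> 1" "m2 \<ge> 1" and sup: "sup_norm X \<le> \<gamma>" and "\<gamma> \<ge> 0"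
  shows "max_norm X \<le> \<gamma> * sqrt (vec_space.rank m1 X)"
proof -
  define r where "r = vec_space.rank m1 X"
  obtain A B where A: "A \<in> carrier_mat m1 r" and B: "B \<in> carrier_mat m2 r" and XAB: "X = A * B\<^sup>T"
    and inj: "\<And>v. v \<in> carrier_vec r \<Longrightarrow> A *\<^sub>v v = 0\<^sub>v m1 \<Longrightarrow> v = 0\<^sub>v r"
    using vec_space.rank_factorization[OF X] unfolding r_def by blast
  obtain p N where p0: "\<And>i. i < m1 \<Longrightarrow> p i \<ge> 0" and p1: "(\<Sum>i<m1. p i) = 1" and N: "N \<in> carrier_mat r r"
    and WN: "design_mat A p * N = 1\<^sub>m r" "N * design_mat A p = 1\<^sub>m r"
    and lev: "\<And>i. i < m1 \<Longrightarrow> (A * N * A\<^sup>T) $$ (i, i) \<le> r"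
    using optimal_design[OF A m(1) inj] by blast
  define S where "S = sqrt_design A p"
  have S: "S \<in> carrier_mat m1 r" using A by (simp add: S_def sqrt_design_def)
  have gram: "S\<^sup>T * S = design_mat A p" unfolding S_def
    using p0 A by (subst design_mat_eq_gram) auto
  define U where "U = A * N * S\<^sup>T"
  define V where "V = B * S\<^sup>T"
  have U: "U \<in> carrier_mat m1 m1" and V: "V \<in> carrier_mat m2 m1"
    using A B N S by (auto simp: U_def V_def)
  have N': "A * N * S\<^sup>T * S = A"
  proof -
    have "A * N * S\<^sup>T * S = A * N * (S\<^sup>T * S)" using A N S by (intro assoc_mult_mat) auto
    also have "\<dots> = A * (N * design_mat A p)" unfolding gram
      using A N by (intro assoc_mult_mat) (auto simp: design_mat_def)
    finally show ?thesis using WN A by simp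
  qed
  have "U * V\<^sup>T = U * (S * B\<^sup>T)" using B S by (simp add: V_def transpose_mult[of _ m2 r _ m1])
  also have "\<dots> = U * S * B\<^sup>T" using U S B by (intro assoc_mult_mat[symmetric]) auto
  also have "\<dots> = X" using N' XAB by (simp add: U_def)
  finally have UV: "X = U * V\<^sup>T" ..
  \<comment> \<open>The product comes out with \<open>N\<^sup>T\<close> in place of
    \<open>N\<close>, that is, as the transpose of the leverage matrix, which has the same
    diagonal.\<close>
  have UU: "U * U\<^sup>T = A * N\<^sup>T * A\<^sup>T"
  proof -
    have "U\<^sup>T = (S\<^sup>T)\<^sup>T * (A * N)\<^sup>T" unfolding U_def using A N S by (intro transpose_mult) auto
    also have "(A * N)\<^sup>T = N\<^sup>T * A\<^sup>T" using A N by (intro transpose_mult) auto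
    finally have "U * U\<^sup>T = U * (S * (N\<^sup>T * A\<^sup>T))" by simp
    also have "\<dots> = U * S * (N\<^sup>T * A\<^sup>T)" using U S N A by (intro assoc_mult_mat[symmetric]) auto
    also have "\<dots> = A * (N\<^sup>T * A\<^sup>T)" using N' by (simp add: U_def)
    also have "\<dots> = A * N\<^sup>T * A\<^sup>T" using A N by (intro assoc_mult_mat[symmetric]) auto
    finally show ?thesis .
  qed
  have "(A * N * A\<^sup>T)\<^sup>T = (A\<^sup>T)\<^sup>T * (A * N)\<^sup>T" using A N by (intro transpose_mult) auto
  also have "(A * N)\<^sup>T = N\<^sup>T * A\<^sup>T" using A N by (intro transpose_mult) auto
  also have "(A\<^sup>T)\<^sup>T * (N\<^sup>T * A\<^sup>T) = A * N\<^sup>T * A\<^sup>T" using A N by (simp del: assoc_mult_mat) (intro assoc_mult_mat[symmetric], auto)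
  finally have "U * U\<^sup>T = (A * N * A\<^sup>T)\<^sup>T" using UU by simp
  then have UUii: "(U * U\<^sup>T) $$ (i, i) = (A * N * A\<^sup>T) $$ (i, i)" if "i < m1" for i
    using A N that by (simp only:) (subst index_transpose_mat, auto)
  \<comment> \<open>The rows of \<open>V\<close> are weighted columns of \<open>X\<close>; this is
    how the entrywise bound enters.\<close>
  have Vij: "V $$ (j, i) = sqrt (p i) * X $$ (i, j)" if "i < m1" "j < m2" for i j
  proof -
    have "V $$ (j, i) = (\<Sum>k = 0..<r. B $$ (j, k) * (sqrt (p i) * A $$ (i, k)))"
      using that A B S by (simp add: V_def scalar_prod_def) (simp add: S_def sqrt_design_def)
    also have "\<dots> = sqrt (p i) * (\<Sum>k = 0..<r. A $$ (i, k) * B $$ (j, k))"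
      by (simp add: sum_distrib_left mult_ac)
    also have "\<dots> = sqrt (p i) * X $$ (i, j)" using that A B by (simp add: XAB scalar_prod_def)
    finally show ?thesis .
  qed
  have nU: "two_inf_norm U \<le> sqrt r"
    using U m lev UUii by (intro two_inf_norm_leI) (auto simp: sum_row_sq_eq_gram[OF U] simp del: index_mult_mat)
  have nV: "two_inf_norm V \<le> \<gamma>"
  proof (rule two_inf_norm_leI)
    fix j assume "j < dim_row V"
    then have j: "j < m2" using V by simp
    have "(\<Sum>i<m1. (V $$ (j, i))^2) = (\<Sum>i<m1. p i * (X $$ (i, j))^2)"
      using j p0 by (intro sum.cong) (auto simp: Vij power_mult_distrib)
    also have "\<dots> \<le> (\<Sum>i<m1. p i * \<gamma>^2)"
    proof (intro sum_mono mult_left_mono)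
      fix i assume "i \<in> {..<m1}"
      then have "\<bar>X $$ (i, j)\<bar> \<le> \<gamma>" using abs_index_le_sup_norm[of i X j] X j sup by auto
      then show "(X $$ (i, j))^2 \<le> \<gamma>^2" using \<open>\<gamma> \<ge> 0\<close> by (simp add: abs_le_square_iff[symmetric])
    qed (use p0 in auto)
    also have "\<dots> = \<gamma>^2" using p1 by (simp add: sum_distrib_right[symmetric])
    finally show "(\<Sum>i<dim_col V. (V $$ (j, i))^2) \<le> \<gamma>^2" using V by simp
  qed (use V m \<open>\<gamma> \<ge> 0\<close> in auto)
  have "max_norm X \<le> two_inf_norm U * two_inf_norm V"
    using X U V m UV by (intro max_norm_le_mult[of _ _ m1]) auto
  also have "\<dots> \<le> sqrt r * \<gamma>"
    using nU nV V m by (intro mult_mono two_inf_norm_nonneg) auto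
  finally show ?thesis by (simp add: r_def mult.commute)
qed

section \<open>Grothendieck's inequality\<close>

text \<open>The value of \<open>\<Sum>i<k. \<epsilon>\<^sub>i * u i\<close> at the sign vector encoded by the binary digits of \<open>j < 2 ^ k\<close>.\<close>

fun rademacher_sum :: "(nat \<Rightarrow> real) \<Rightarrow> nat \<Rightarrow> nat \<Rightarrow> real" where
  "rademacher_sum u 0 j = 0"
| "rademacher_sum u (Suc k) j = rademacher_sum u k (j div 2) + (if even j then u k else - u k)"

lemma sum_lessThan_double:
  fixes f :: "nat \<Rightarrow> real"
  shows "(\<Sum>j<2*n. f j) = (\<Sum>j<n. f (2*j) + f (2*j+1))"
  by (induction n) auto

text \<open>Rademacher functions are orthonormal. The indices \<open>2 * j\<close> and
  \<open>2 * j + 1\<close> differ only in the newest sign, so the cross terms cancel within each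
  pair.\<close>

lemma sum_rademacher_mult:
  "(\<Sum>j<2^k. rademacher_sum u k j * rademacher_sum v k j) = 2^k * (\<Sum>i<k. u i * v i)"
proof (induction k)
  case (Suc k)
  have "(\<Sum>j<2^Suc k. rademacher_sum u (Suc k) j * rademacher_sum v (Suc k) j) =
     (\<Sum>j<2^k. 2 * (rademacher_sum u k j * rademacher_sum v k j) + 2 * (u k * v k))"
    unfolding power_Suc sum_lessThan_double
    by (rule sum.cong) (auto simp: algebra_simps)
  also have "\<dots> = 2^Suc k * (\<Sum>i<Suc k. u i * v i)"
    by (simp add: sum.distrib sum_distrib_left[symmetric] Suc algebra_simps)
  finally show ?case .
qed simp

text \<open>Khintchine's inequality for the fourth moment. In \<open>(x + y)^4 + (x - y)^4\<close>
  the odd powers cancel, so the induction needs only the second moment besides the fourth.\<close>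

lemma sum_rademacher_power4:
  "(\<Sum>j<2^k. rademacher_sum u k j ^ 4) \<le> 3 * 2^k * (\<Sum>i<k. u i ^ 2)^2"
proof (induction k)
  case (Suc k)
  define s where "s = (\<Sum>i<k. u i ^ 2)"
  have sq: "(\<Sum>j<2^k. rademacher_sum u k j ^ 2) = 2^k * s"
    using sum_rademacher_mult[of u k u] by (simp add: power2_eq_square s_def)
  have "(\<Sum>j<2^Suc k. rademacher_sum u (Suc k) j ^ 4) =
     (\<Sum>j<2^k. 2 * rademacher_sum u k j ^ 4 + 12 * (u k)^2 * (rademacher_sum u k j)^2 + 2 * (u k)^4)"
    unfolding power_Suc sum_lessThan_double
  proof (rule sum.cong)
    fix j
    have "(x + y)^4 + (x - y)^4 = 2 * x^4 + 12 * y^2 * x^2 + 2 * y^4" for x y :: real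
      by (simp add: power4_eq_xxxx power2_eq_square algebra_simps)
    from this[of "rademacher_sum u k j" "u k"]
    show "rademacher_sum u (Suc k) (2*j) ^ 4 + rademacher_sum u (Suc k) (2*j+1) ^ 4 =
      2 * rademacher_sum u k j ^ 4 + 12 * (u k)^2 * (rademacher_sum u k j)^2 + 2 * (u k)^4"
      by simp
  qed simp
  also have "\<dots> = 2 * (\<Sum>j<2^k. rademacher_sum u k j ^ 4) + 12 * (u k)^2 * (2^k * s) + 2 * 2^k * (u k)^4"
    by (simp add: sum.distrib sum_distrib_left[symmetric] sq)
  also have "\<dots> \<le> 2 * (3 * 2^k * s^2) + 12 * (u k)^2 * (2^k * s) + 2 * 2^k * (u k)^4"
    using Suc by (simp add: s_def)
  \<comment> \<open>Raising the coefficient 2 to 6 completes the square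
    \<open>(s + (u k)^2)^2\<close>.\<close>
  also have "\<dots> \<le> 2 * (3 * 2^k * s^2) + 12 * (u k)^2 * (2^k * s) + 6 * 2^k * (u k)^4"
    by simp
  also have "\<dots> = 3 * 2^Suc k * (\<Sum>i<Suc k. u i ^ 2)^2"
    by (simp add: s_def[symmetric]) (simp add: power4_eq_xxxx power2_eq_square algebra_simps)
  finally show ?case .
qed simp

text \<open>At level 2 the tails have squared norm at most \<open>3/64 \<le> (1/4)^2\<close>, so two
  tail terms together absorb only half of the Grothendieck quantity.\<close>

definition trunc2 :: "real \<Rightarrow> real" where "trunc2 x = max (-2) (min 2 x)"

lemma trunc2_bound: "\<bar>trunc2 x\<bar> \<le> 2" by (simp add: trunc2_def)

lemma trunc2_sq: "(trunc2 x)^2 \<le> x^2"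
  by (intro abs_le_square_iff[THEN iffD1]) (auto simp: trunc2_def)

text \<open>Beyond the level, \<open>\<bar>x\<bar> - 2 \<le> x^2 / 8\<close> is equivalent to
  \<open>(\<bar>x\<bar> - 4)^2 \<ge> 0\<close>.\<close>

lemma trunc2_tail: "(x - trunc2 x)^2 \<le> x^4 / 64"
proof -
  have "\<bar>x - trunc2 x\<bar> \<le> x^2 / 8"
    using zero_le_power2[of "x-4"] zero_le_power2[of "x+4"]
    by (auto simp: trunc2_def max_def min_def power2_eq_square algebra_simps)
  then have "\<bar>x - trunc2 x\<bar>^2 \<le> (x^2/8)^2" by (rule power_mono) simp
  then show ?thesis by (simp add: power_divide)
qed

text \<open>A bilinear form on a box is largest at a vertex: with \<open>t\<close> fixed,
  \<open>s\<close> is replaced by \<open>M\<close> times the signs of its coefficients, and then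
  \<open>t\<close> likewise.\<close>

lemma bilinear_box_le_sign:
  fixes G :: "nat \<Rightarrow> nat \<Rightarrow> real"
  assumes T: "\<And>x y. x \<in> {..<m1} \<rightarrow>\<^sub>E {-1,1} \<Longrightarrow> y \<in> {..<m2} \<rightarrow>\<^sub>E {-1,1} \<Longrightarrow>
      (\<Sum>a<m1. \<Sum>b<m2. G a b * x a * y b) \<le> T"
    and s: "\<And>a. a < m1 \<Longrightarrow> \<bar>s a\<bar> \<le> M" and t: "\<And>b. b < m2 \<Longrightarrow> \<bar>t b\<bar> \<le> M" and M: "M \<ge> 0"
  shows "(\<Sum>a<m1. \<Sum>b<m2. G a b * s a * t b) \<le> M^2 * T"
proof -
  have lin: "\<exists>x \<in> {..<m} \<rightarrow>\<^sub>E {-1,1}. (\<Sum>a<m. c a * s a) \<le> M * (\<Sum>a<m. c a * x a)"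
    if "\<And>a. a < m \<Longrightarrow> \<bar>s a\<bar> \<le> M" for m and c s :: "nat \<Rightarrow> real"
  proof (rule bexI)
    let ?x = "\<lambda>a\<in>{..<m}. if c a \<ge> 0 then 1 else (-1::real)"
    show "(\<Sum>a<m. c a * s a) \<le> M * (\<Sum>a<m. c a * ?x a)"
      unfolding sum_distrib_left
    proof (rule sum_mono)
      fix a assume "a \<in> {..<m}"
      then have "\<bar>s a\<bar> \<le> M" using that by simp
      have "c a * s a \<le> \<bar>c a\<bar> * \<bar>s a\<bar>" by (metis abs_ge_self abs_mult)
      also have "\<dots> \<le> \<bar>c a\<bar> * M" using \<open>\<bar>s a\<bar> \<le> M\<close> by (simp add: mult_left_mono)
      finally show "c a * s a \<le> M * (c a * ?x a)" using \<open>a \<in> _\<close> by (simp add: abs_if mult.commute split: if_splits)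
    qed
    show "?x \<in> {..<m} \<rightarrow>\<^sub>E {-1,1}" by auto
  qed
  obtain x where x: "x \<in> {..<m1} \<rightarrow>\<^sub>E {-1,1}"
    and 1: "(\<Sum>a<m1. (\<Sum>b<m2. G a b * t b) * s a) \<le> M * (\<Sum>a<m1. (\<Sum>b<m2. G a b * t b) * x a)"
    using lin[of m1 s "\<lambda>a. \<Sum>b<m2. G a b * t b"] s by blast
  obtain y where y: "y \<in> {..<m2} \<rightarrow>\<^sub>E {-1,1}"
    and 2: "(\<Sum>b<m2. (\<Sum>a<m1. G a b * x a) * t b) \<le> M * (\<Sum>b<m2. (\<Sum>a<m1. G a b * x a) * y b)"
    using lin[of m2 t "\<lambda>b. \<Sum>a<m1. G a b * x a"] t by blast
  have e1: "(\<Sum>a<m1. \<Sum>b<m2. G a b * s a * t b) = (\<Sum>a<m1. (\<Sum>b<m2. G a b * t b) * s a)"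
    by (simp add: sum_distrib_left sum_distrib_right mult_ac)
  have e2: "(\<Sum>a<m1. (\<Sum>b<m2. G a b * t b) * x a) = (\<Sum>b<m2. (\<Sum>a<m1. G a b * x a) * t b)"
    unfolding sum_distrib_right by (subst sum.swap) (simp add: mult_ac)
  have e3: "(\<Sum>b<m2. (\<Sum>a<m1. G a b * x a) * y b) = (\<Sum>a<m1. \<Sum>b<m2. G a b * x a * y b)"
    unfolding sum_distrib_right by (subst sum.swap) (simp add: mult_ac)
  have "(\<Sum>a<m1. \<Sum>b<m2. G a b * s a * t b) \<le> M * (M * (\<Sum>a<m1. \<Sum>b<m2. G a b * x a * y b))"
    using 1 mult_left_mono[OF 2 M] unfolding e1 e2 e3 by (rule order_trans)
  also have "\<dots> \<le> M * (M * T)" using T[OF x y] M by (intro mult_left_mono) auto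
  finally show ?thesis by (simp add: power2_eq_square mult_ac)
qed

section \<open>The dual of the max-norm\<close>

definition vec_bilinear :: "nat \<Rightarrow> nat \<Rightarrow> (nat \<Rightarrow> nat \<Rightarrow> real) \<Rightarrow> nat
    \<Rightarrow> (nat \<Rightarrow> nat \<Rightarrow> real) \<Rightarrow> (nat \<Rightarrow> nat \<Rightarrow> real) \<Rightarrow> real" where
  "vec_bilinear m1 m2 G k u v = (\<Sum>a<m1. \<Sum>b<m2. G a b * (\<Sum>i<k. u a i * v b i))"

definition rows_le :: "nat \<Rightarrow> nat \<Rightarrow> (nat \<Rightarrow> nat \<Rightarrow> real) \<Rightarrow> real \<Rightarrow> bool" where
  "rows_le m k u \<alpha> \<longleftrightarrow> (\<forall>a<m. (\<Sum>i<k. u a i ^ 2) \<le> \<alpha>^2)"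

definition gamma2_dual :: "nat \<Rightarrow> nat \<Rightarrow> (nat \<Rightarrow> nat \<Rightarrow> real) \<Rightarrow> real" where
  "gamma2_dual m1 m2 G = Sup {vec_bilinear m1 m2 G k u v | k u v. rows_le m1 k u 1 \<and> rows_le m2 k v 1}"

text \<open>Cauchy--Schwarz bounds every inner product by 1, which makes the supremum
  finite.\<close>

lemma vec_bilinear_le_gamma2_dual_unit:
  assumes "rows_le m1 k u 1" "rows_le m2 k v 1"
  shows "vec_bilinear m1 m2 G k u v \<le> gamma2_dual m1 m2 G"
  unfolding gamma2_dual_def
proof (rule cSup_upper)
  show "bdd_above {vec_bilinear m1 m2 G k u v | k u v. rows_le m1 k u 1 \<and> rows_le m2 k v 1}"
  proof (rule bdd_aboveI[of _ "\<Sum>a<m1. \<Sum>b<m2. \<bar>G a b\<bar>"], safe)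
    fix k u v assume uv: "rows_le m1 k u 1" "rows_le m2 k v 1"
    have "G a b * (\<Sum>i<k. u a i * v b i) \<le> \<bar>G a b\<bar>" if "a < m1" "b < m2" for a b
    proof -
      have "\<bar>\<Sum>i<k. u a i * v b i\<bar> \<le> L2_set (u a) {..<k} * L2_set (v b) {..<k}"
        using L2_set_mult_ineq[of "u a" "v b" "{..<k}"]
          sum_abs[of "\<lambda>i. u a i * v b i" "{..<k}"] by (simp add: abs_mult)
      also have "\<dots> \<le> 1 * 1" using uv that
        by (intro mult_mono) (auto simp: rows_le_def L2_set_def sum_nonneg)
      finally have "\<bar>G a b * (\<Sum>i<k. u a i * v b i)\<bar> \<le> \<bar>G a b\<bar>"
        by (simp add: abs_mult mult_left_le)
      then show ?thesis by linarith
    qed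
    then show "vec_bilinear m1 m2 G k u v \<le> (\<Sum>a<m1. \<Sum>b<m2. \<bar>G a b\<bar>)"
      unfolding vec_bilinear_def by (intro sum_mono) auto
  qed
qed (use assms in blast)

text \<open>Homogeneity reduces this to unit rows. A zero bound cannot be scaled away, but then the
  form vanishes.\<close>

lemma vec_bilinear_le_gamma2_dual:
  assumes u: "rows_le m1 k u \<alpha>" and v: "rows_le m2 k v \<beta>" and "\<alpha> \<ge> 0" "\<beta> \<ge> 0"
  shows "vec_bilinear m1 m2 G k u v \<le> \<alpha> * \<beta> * gamma2_dual m1 m2 G"
proof (cases "\<alpha> = 0 \<or> \<beta> = 0")
  case True
  have z: "w a i = 0" if "rows_le m k w 0" "a < m" "i < k" for m w a i
  proof -
    have "(\<Sum>i<k. w a i ^ 2) = 0" using that by (simp add: rows_le_def sum_nonneg antisym)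
    then have "w a i ^ 2 = 0" using that(3) by (subst (asm) sum_nonneg_eq_0_iff) auto
    then show ?thesis by simp
  qed
  have "(\<Sum>i<k. u a i * v b i) = 0" if "a < m1" "b < m2" for a b
    using True z[of m1 u a] z[of m2 v b] u v that by (intro sum.neutral) auto
  then have "vec_bilinear m1 m2 G k u v = 0" by (simp add: vec_bilinear_def)
  then show ?thesis using True by auto
next
  case False
  then have pos: "\<alpha> > 0" "\<beta> > 0" using assms by auto
  have sc: "rows_le m k (\<lambda>a i. w a i / c) 1" if "rows_le m k w c" "c > 0" for m w c
    using that by (auto simp: rows_le_def power_divide sum_divide_distrib[symmetric])
  have "vec_bilinear m1 m2 G k u v = \<alpha> * \<beta> * vec_bilinear m1 m2 G k (\<lambda>a i. u a i / \<alpha>) (\<lambda>a i. v a i / \<beta>)"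
    unfolding vec_bilinear_def sum_distrib_left using pos by simp
  also have "\<dots> \<le> \<alpha> * \<beta> * gamma2_dual m1 m2 G"
    using pos by (intro mult_left_mono vec_bilinear_le_gamma2_dual_unit sc u v) auto
  finally show ?thesis .
qed

text \<open>Replacing vectors by Rademacher sums turns inner products into expectations. The sums truncated
  at \<open>2\<close> contribute at most \<open>4 * T\<close>. By the fourth moment bound the tails have norm at most \<open>1 / 4\<close>,
  and as vectors in dimension \<open>2 ^ k\<close> they are again controlled by \<open>gamma2_dual\<close>, whence
  \<open>K \<le> 4 * T + K / 2\<close>.\<close>

lemma grothendieck_inequality:
  assumes T: "\<And>x y. x \<in> {..<m1} \<rightarrow>\<^sub>E {-1,1} \<Longrightarrow> y \<in> {..<m2} \<rightarrow>\<^sub>E {-1,1} \<Longrightarrow>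
      (\<Sum>a<m1. \<Sum>b<m2. G a b * x a * y b) \<le> T"
  shows "gamma2_dual m1 m2 G \<le> 8 * T"
proof -
  define K where "K = gamma2_dual m1 m2 G"
  have "vec_bilinear m1 m2 G k u v \<le> 4 * T + K / 2" if u: "rows_le m1 k u 1" and v: "rows_le m2 k v 1" for k u v
  proof -
    define N :: nat where "N = 2^k"
    \<comment> \<open>Division by \<open>c\<close> in each factor turns sums over the
      \<open>2 ^ k\<close> sign vectors into expectations, so that \<open>full\<close> preserves
      inner products.\<close>
    define c :: real where "c = sqrt (2^k)"
    have c: "c > 0" "c * c = 2^k" "c^2 = 2^k" by (auto simp: c_def)
    define X where "X = (\<lambda>(w :: nat \<Rightarrow> nat \<Rightarrow> real) (a::nat) j. rademacher_sum (w a) k j)"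
    define full where "full = (\<lambda>(w :: nat \<Rightarrow> nat \<Rightarrow> real) (a::nat) j. X w a j / c)"
    define low where "low = (\<lambda>(w :: nat \<Rightarrow> nat \<Rightarrow> real) (a::nat) j. trunc2 (X w a j) / c)"
    define tail where "tail = (\<lambda>(w :: nat \<Rightarrow> nat \<Rightarrow> real) (a::nat) j. (X w a j - trunc2 (X w a j)) / c)"
    have inner: "(\<Sum>i<k. u a i * v b i) = (\<Sum>j<N. full u a j * full v b j)" for a b
      unfolding full_def X_def N_def using sum_rademacher_mult[of "u a" k "v b"] c
      by (simp add: sum_divide_distrib[symmetric])
    have fl: "full w a j = low w a j + tail w a j" for w a j
      by (simp add: full_def low_def tail_def diff_divide_distrib)
    have rows_full: "rows_le m N (full w) 1" if "rows_le m k w 1" for m w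
      unfolding rows_le_def
    proof safe
      fix a assume "a < m"
      have "(\<Sum>i<N. (full w a i)^2) = (\<Sum>i<k. w a i ^ 2)"
        unfolding full_def X_def N_def using sum_rademacher_mult[of "w a" k "w a"] c
        by (simp add: sum_divide_distrib[symmetric] power_divide power2_eq_square)
      then show "(\<Sum>i<N. (full w a i)^2) \<le> 1^2" using that \<open>a < m\<close> by (simp add: rows_le_def)
    qed
    have rows_low: "rows_le m N (low w) 1" if "rows_le m k w 1" for m w
      unfolding rows_le_def
    proof safe
      fix a assume "a < m"
      have "(\<Sum>i<N. (low w a i)^2) \<le> (\<Sum>i<N. (full w a i)^2)"
        unfolding low_def full_def power_divide
        by (intro sum_mono divide_right_mono trunc2_sq) auto
      also have "\<dots> \<le> 1^2" using rows_full[OF that] \<open>a < m\<close> by (simp add: rows_le_def)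
      finally show "(\<Sum>i<N. (low w a i)^2) \<le> 1^2" .
    qed
    have rows_tail: "rows_le m N (tail w) (1/4)" if "rows_le m k w 1" for m w
      unfolding rows_le_def
    proof safe
      fix a assume "a < m"
      have s1: "(\<Sum>i<k. w a i ^ 2) \<le> 1" using that \<open>a < m\<close> by (simp add: rows_le_def)
      have "(\<Sum>i<N. (tail w a i)^2) \<le> (\<Sum>i<N. (X w a i ^ 4 / 64) / c^2)"
        unfolding tail_def power_divide
        by (intro sum_mono divide_right_mono trunc2_tail) auto
      also have "\<dots> = (\<Sum>i<N. X w a i ^ 4) / (64 * 2^k)"
        using c by (simp add: sum_divide_distrib[symmetric])
      also have "\<dots> \<le> (3 * 2^k * (\<Sum>i<k. w a i ^ 2)^2) / (64 * 2^k)"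
        unfolding X_def N_def by (intro divide_right_mono sum_rademacher_power4) auto
      also have "\<dots> = 3 / 64 * (\<Sum>i<k. w a i ^ 2)^2" by simp
      also have "\<dots> \<le> 3 / 64 * 1"
        using s1 by (intro mult_left_mono power_le_one) (auto simp: sum_nonneg)
      also have "\<dots> \<le> (1/4)^2" by (simp add: power2_eq_square)
      finally show "(\<Sum>i<N. (tail w a i)^2) \<le> (1/4)^2" .
    qed
    \<comment> \<open>The split is low-low, tail-low and full-tail, so that each remainder pairs one
      tail with vectors of norm at most 1.\<close>
    have "vec_bilinear m1 m2 G k u v = vec_bilinear m1 m2 G N (low u) (low v)
        + vec_bilinear m1 m2 G N (tail u) (low v) + vec_bilinear m1 m2 G N (full u) (tail v)"
    proof -
      have "(\<Sum>j<N. full u a j * full v b j) = (\<Sum>j<N. low u a j * low v b j)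
         + (\<Sum>j<N. tail u a j * low v b j) + (\<Sum>j<N. full u a j * tail v b j)" for a b
        unfolding sum.distrib[symmetric] by (rule sum.cong) (auto simp: fl algebra_simps)
      then show ?thesis unfolding vec_bilinear_def inner
        by (simp add: distrib_left sum.distrib)
    qed
    moreover have "vec_bilinear m1 m2 G N (low u) (low v) \<le> 4 * T"
    proof -
      have "vec_bilinear m1 m2 G N (low u) (low v) =
          (\<Sum>a<m1. \<Sum>b<m2. \<Sum>j<N. G a b * trunc2 (X u a j) * trunc2 (X v b j) / 2^k)"
        unfolding vec_bilinear_def low_def sum_distrib_left using c by (simp add: mult_ac)
      also have "\<dots> = (\<Sum>j<N. (\<Sum>a<m1. \<Sum>b<m2. G a b * trunc2 (X u a j) * trunc2 (X v b j)) / 2^k)"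
        by (simp add: sum_divide_distrib sum.swap[of _ "{..<N}" "{..<m2}"] sum.swap[of _ "{..<N}" "{..<m1}"])
      also have "\<dots> \<le> (\<Sum>j<N. 2^2 * T / 2^k)"
        by (intro sum_mono divide_right_mono bilinear_box_le_sign T trunc2_bound) auto
      also have "\<dots> = 4 * T" by (simp add: N_def)
      finally show ?thesis .
    qed
    moreover have "vec_bilinear m1 m2 G N (tail u) (low v) \<le> 1/4 * 1 * K" unfolding K_def
      by (intro vec_bilinear_le_gamma2_dual rows_tail rows_low u v) auto
    moreover have "vec_bilinear m1 m2 G N (full u) (tail v) \<le> 1 * (1/4) * K" unfolding K_def
      by (intro vec_bilinear_le_gamma2_dual rows_full rows_tail u v) auto
    ultimately show ?thesis by linarith
  qed
  \<comment> \<open>Vectors of dimension 0 show that the set in the supremum is nonempty.\<close>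
  moreover have "rows_le m1 0 (\<lambda>_ _. 0) 1" "rows_le m2 0 (\<lambda>_ _. 0) 1" by (auto simp: rows_le_def)
  ultimately have "gamma2_dual m1 m2 G \<le> 4 * T + K / 2"
    unfolding gamma2_dual_def by (intro cSup_least) blast+
  then show ?thesis by (simp add: K_def)
qed

section \<open>Symmetrization and contraction\<close>

text \<open>Real suprema are meaningful only for functions bounded above, so boundedness is carried
  along for every offset.\<close>

definition bounded_fun_on :: "'z set \<Rightarrow> ('z \<Rightarrow> real) \<Rightarrow> bool" where
  "bounded_fun_on T h \<longleftrightarrow> (\<exists>B. \<forall>z\<in>T. \<bar>h z\<bar> \<le> B)"

lemma bounded_fun_on_add [intro]:
  assumes "bounded_fun_on T f" "bounded_fun_on T g"
  shows "bounded_fun_on T (\<lambda>z. f z + g z)"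
proof -
  obtain B C where "\<forall>z\<in>T. \<bar>f z\<bar> \<le> B" "\<forall>z\<in>T. \<bar>g z\<bar> \<le> C"
    using assms by (auto simp: bounded_fun_on_def)
  then have "\<forall>z\<in>T. \<bar>f z + g z\<bar> \<le> B + C" by (metis abs_triangle_ineq add_mono order_trans)
  then show ?thesis by (auto simp: bounded_fun_on_def)
qed

lemma bounded_fun_on_cmult [intro]:
  assumes "bounded_fun_on T f"
  shows "bounded_fun_on T (\<lambda>z. c * f z)"
proof -
  obtain B where "\<forall>z\<in>T. \<bar>f z\<bar> \<le> B" using assms by (auto simp: bounded_fun_on_def)
  then have "\<forall>z\<in>T. \<bar>c * f z\<bar> \<le> \<bar>c\<bar> * B" by (auto simp: abs_mult mult_left_mono)
  then show ?thesis by (auto simp: bounded_fun_on_def)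
qed

lemma bounded_fun_on_diff [intro]:
  "bounded_fun_on T f \<Longrightarrow> bounded_fun_on T g \<Longrightarrow> bounded_fun_on T (\<lambda>z. f z - g z)"
  using bounded_fun_on_add[OF _ bounded_fun_on_cmult[of T g "-1"], of f] by simp

lemma bounded_fun_on_sum [intro]:
  "(\<And>i. i \<in> I \<Longrightarrow> bounded_fun_on T (f i)) \<Longrightarrow> bounded_fun_on T (\<lambda>z. \<Sum>i\<in>I. f i z)"
proof (induction I rule: infinite_finite_induct)
  case (insert i I)
  then show ?case using bounded_fun_on_add[of T "f i" "\<lambda>z. \<Sum>i\<in>I. f i z"] by simp
qed (auto simp: bounded_fun_on_def)

lemma bounded_fun_on_upper:
  assumes "bounded_fun_on T h" "z \<in> T"
  shows "h z \<le> (SUP z\<in>T. h z)"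
proof -
  obtain B where "\<forall>z\<in>T. \<bar>h z\<bar> \<le> B" using assms by (auto simp: bounded_fun_on_def)
  then have "bdd_above (h ` T)" by (intro bdd_aboveI2[of _ _ B]) (auto simp: abs_le_iff)
  then show ?thesis using assms(2) by (intro cSUP_upper)
qed

locale weighted_family =
  fixes T :: "'z set" and A :: "'s set" and p :: "'s \<Rightarrow> real"
  assumes T_ne: "T \<noteq> {}" and finite_A: "finite A"
    and p_nonneg: "\<And>s. s \<in> A \<Longrightarrow> p s \<ge> 0" and p_sum: "(\<Sum>s\<in>A. p s) = 1"
begin

text \<open>The expectation of \<open>SUP z\<in>T. h z + (\<Sum>i<n. \<epsilon>\<^sub>i * \<phi> S\<^sub>i z)\<close> for \<open>n\<close> independent draws
  \<open>S\<^sub>i\<close> from the weights \<open>p\<close> and independent fair signs \<open>\<epsilon>\<^sub>i\<close>, unfolded one draw at a time.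
  Quantifying over the offset \<open>h\<close> is what makes the inductions on \<open>n\<close> below go through.\<close>

fun rad_sup :: "('s \<Rightarrow> 'z \<Rightarrow> real) \<Rightarrow> nat \<Rightarrow> ('z \<Rightarrow> real) \<Rightarrow> real" where
  "rad_sup \<phi> 0 h = (SUP z\<in>T. h z)"
| "rad_sup \<phi> (Suc n) h =
    (\<Sum>s\<in>A. p s * ((rad_sup \<phi> n (\<lambda>z. h z + \<phi> s z) + rad_sup \<phi> n (\<lambda>z. h z - \<phi> s z)) / 2))"

fun centered_sup :: "('s \<Rightarrow> 'z \<Rightarrow> real) \<Rightarrow> nat \<Rightarrow> ('z \<Rightarrow> real) \<Rightarrow> real" where
  "centered_sup \<phi> 0 h = (SUP z\<in>T. h z)"
| "centered_sup \<phi> (Suc n) h =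
    (\<Sum>s\<in>A. p s * centered_sup \<phi> n (\<lambda>z. h z + ((\<Sum>t\<in>A. p t * \<phi> t z) - \<phi> s z)))"

text \<open>An average of suprema of functions affine in the offset is convex in the offset.\<close>

lemma rad_sup_jensen:
  assumes I: "finite I" "\<And>i. i \<in> I \<Longrightarrow> q i \<ge> 0" "(\<Sum>i\<in>I. q i) = 1"
    and \<phi>: "\<And>s. s \<in> A \<Longrightarrow> bounded_fun_on T (\<phi> s)"
    and h: "\<And>i. i \<in> I \<Longrightarrow> bounded_fun_on T (h i)"
  shows "rad_sup \<phi> n (\<lambda>z. \<Sum>i\<in>I. q i * h i z) \<le> (\<Sum>i\<in>I. q i * rad_sup \<phi> n (h i))"
  using h
proof (induction n arbitrary: h)
  case 0
  show ?case unfolding rad_sup.simps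
    using T_ne 0 I by (intro cSUP_least sum_mono mult_left_mono bounded_fun_on_upper)
next
  case (Suc n)
  have add: "(\<lambda>z. (\<Sum>i\<in>I. q i * h i z) + f z) = (\<lambda>z. \<Sum>i\<in>I. q i * (h i z + f z))" for f
    using I by (simp add: distrib_left sum.distrib sum_distrib_right[symmetric])
  have diff: "(\<lambda>z. (\<Sum>i\<in>I. q i * h i z) - f z) = (\<lambda>z. \<Sum>i\<in>I. q i * (h i z - f z))" for f
    using I by (simp add: right_diff_distrib sum_subtractf sum_distrib_right[symmetric])
  have "rad_sup \<phi> (Suc n) (\<lambda>z. \<Sum>i\<in>I. q i * h i z) \<le>
     (\<Sum>s\<in>A. p s * (((\<Sum>i\<in>I. q i * rad_sup \<phi> n (\<lambda>z. h i z + \<phi> s z))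
        + (\<Sum>i\<in>I. q i * rad_sup \<phi> n (\<lambda>z. h i z - \<phi> s z))) / 2))"
    unfolding rad_sup.simps add diff
    using Suc.prems \<phi> p_nonneg
    by (intro sum_mono mult_left_mono divide_right_mono add_mono Suc.IH) auto
  also have "\<dots> = (\<Sum>i\<in>I. q i * rad_sup \<phi> (Suc n) (h i))"
    unfolding rad_sup.simps sum_distrib_left sum.distrib[symmetric] sum_divide_distrib
    by (subst sum.swap) (simp add: algebra_simps add_divide_distrib)
  finally show ?case .
qed

lemma rad_sup_midpoint:
  assumes \<phi>: "\<And>s. s \<in> A \<Longrightarrow> bounded_fun_on T (\<phi> s)"
    and "bounded_fun_on T f" "bounded_fun_on T g"
  shows "rad_sup \<phi> n (\<lambda>z. (f z + g z) / 2) \<le> (rad_sup \<phi> n f + rad_sup \<phi> n g) / 2"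
  using rad_sup_jensen[of "UNIV::bool set" "\<lambda>_. 1/2" \<phi> "\<lambda>b. if b then f else g" n] assms
  by (simp add: UNIV_bool algebra_simps add_divide_distrib)

text \<open>The mean is an average over an independent copy \<open>t\<close>, so the new offset
  averages midpoints of \<open>h + 2 * \<phi> t\<close> and \<open>h - 2 * \<phi> s\<close>.
  Convexity separates the two, and since \<open>s\<close> and \<open>t\<close> have the same law
  they recombine into one draw with a random sign.\<close>

lemma symmetrization:
  assumes \<phi>: "\<And>s. s \<in> A \<Longrightarrow> bounded_fun_on T (\<phi> s)" and h: "bounded_fun_on T h"
  shows "centered_sup \<phi> n h \<le> rad_sup (\<lambda>s z. 2 * \<phi> s z) n h"
  using h
proof (induction n arbitrary: h)
  case (Suc n)
  let ?Q = "rad_sup (\<lambda>s z. 2 * \<phi> s z) n"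
  have \<phi>2: "bounded_fun_on T (\<lambda>z. 2 * \<phi> s z)" if "s \<in> A" for s using \<phi> that by blast
  have "centered_sup \<phi> n (\<lambda>z. h z + ((\<Sum>t\<in>A. p t * \<phi> t z) - \<phi> s z)) \<le>
      (\<Sum>t\<in>A. p t * ((?Q (\<lambda>z. h z + 2 * \<phi> t z) + ?Q (\<lambda>z. h z - 2 * \<phi> s z)) / 2))"
    if s: "s \<in> A" for s
  proof -
    let ?g = "\<lambda>z. h z + ((\<Sum>t\<in>A. p t * \<phi> t z) - \<phi> s z)"
    have eq: "?g = (\<lambda>z. \<Sum>t\<in>A. p t * (((h z + 2 * \<phi> t z) + (h z - 2 * \<phi> s z)) / 2))"
      using p_sum by (simp add: algebra_simps add_divide_distrib diff_divide_distrib sum.distrib sum_subtractf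
          sum_distrib_left[symmetric] sum_distrib_right[symmetric])
    have "centered_sup \<phi> n ?g \<le> ?Q ?g"
      using Suc.prems \<phi> s by (intro Suc.IH bounded_fun_on_add bounded_fun_on_diff bounded_fun_on_sum
          bounded_fun_on_cmult) auto
    also have "?Q ?g = ?Q (\<lambda>z. \<Sum>t\<in>A. p t * (((h z + 2 * \<phi> t z) + (h z - 2 * \<phi> s z)) / 2))"
      by (simp only: eq)
    also have "\<dots> \<le> (\<Sum>t\<in>A. p t * ?Q (\<lambda>z. ((h z + 2 * \<phi> t z) + (h z - 2 * \<phi> s z)) / 2))"
    proof (rule rad_sup_jensen[OF finite_A p_nonneg p_sum \<phi>2])
      fix t assume "t \<in> A"
      then have "bounded_fun_on T (\<lambda>z. 1/2 * ((h z + 2 * \<phi> t z) + (h z - 2 * \<phi> s z)))"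
        using Suc.prems \<phi> s by (intro bounded_fun_on_cmult bounded_fun_on_add bounded_fun_on_diff)
      then show "bounded_fun_on T (\<lambda>z. ((h z + 2 * \<phi> t z) + (h z - 2 * \<phi> s z)) / 2)" by simp
    qed
    also have "\<dots> \<le> (\<Sum>t\<in>A. p t * ((?Q (\<lambda>z. h z + 2 * \<phi> t z) + ?Q (\<lambda>z. h z - 2 * \<phi> s z)) / 2))"
      using Suc.prems \<phi> s \<phi>2 p_nonneg
      by (intro sum_mono mult_left_mono rad_sup_midpoint bounded_fun_on_add bounded_fun_on_diff) auto
    finally show ?thesis .
  qed
  then have "centered_sup \<phi> (Suc n) h \<le> (\<Sum>s\<in>A. p s *
      (\<Sum>t\<in>A. p t * ((?Q (\<lambda>z. h z + 2 * \<phi> t z) + ?Q (\<lambda>z. h z - 2 * \<phi> s z)) / 2)))"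
    unfolding centered_sup.simps using p_nonneg by (intro sum_mono mult_left_mono) auto
  also have "\<dots> = rad_sup (\<lambda>s z. 2 * \<phi> s z) (Suc n) h"
    unfolding rad_sup.simps using p_sum
    by (simp add: algebra_simps add_divide_distrib sum.distrib
          sum_distrib_left[symmetric] sum_distrib_right[symmetric] sum_divide_distrib[symmetric])
  finally show ?case .
qed simp

text \<open>The contraction for a single sign. With no further draws, the two suprema are tested at
  a pair \<open>z\<close>, \<open>w\<close>; the absolute value in the Lipschitz bound is resolved
  by exchanging \<open>z\<close> and \<open>w\<close> on the right.\<close>

lemma rad_sup_contract_one:
  assumes \<psi>: "\<And>s. s \<in> A \<Longrightarrow> bounded_fun_on T (\<psi> s)"
    and f: "bounded_fun_on T f" and g: "bounded_fun_on T g"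
    and lip: "\<And>z w. z \<in> T \<Longrightarrow> w \<in> T \<Longrightarrow> \<bar>f z - f w\<bar> \<le> \<bar>g z - g w\<bar>"
    and h: "bounded_fun_on T h"
  shows "rad_sup \<psi> n (\<lambda>z. h z + f z) + rad_sup \<psi> n (\<lambda>z. h z - f z)
    \<le> rad_sup \<psi> n (\<lambda>z. h z + g z) + rad_sup \<psi> n (\<lambda>z. h z - g z)"
  using h
proof (induction n arbitrary: h)
  case 0
  let ?R = "(SUP z\<in>T. h z + g z) + (SUP z\<in>T. h z - g z)"
  have pair: "(h z + f z) + (h w - f w) \<le> ?R" if zw: "z \<in> T" "w \<in> T" for z w
  proof -
    have up: "h z + g z \<le> (SUP z\<in>T. h z + g z)" "h z - g z \<le> (SUP z\<in>T. h z - g z)" if "z \<in> T" for z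
      using bounded_fun_on_upper[OF bounded_fun_on_add[OF 0 g] that]
        bounded_fun_on_upper[OF bounded_fun_on_diff[OF 0 g] that] by auto
    show ?thesis using lip[OF zw] up[OF zw(1)] up[OF zw(2)] by linarith
  qed
  have "(SUP z\<in>T. h z + f z) \<le> ?R - (SUP w\<in>T. h w - f w)"
  proof (rule cSUP_least[OF T_ne])
    fix z assume z: "z \<in> T"
    have "(SUP w\<in>T. h w - f w) \<le> ?R - (h z + f z)"
    proof (rule cSUP_least[OF T_ne])
      fix w assume "w \<in> T"
      then show "h w - f w \<le> ?R - (h z + f z)" using pair[OF z] by fastforce
    qed
    then show "h z + f z \<le> ?R - (SUP w\<in>T. h w - f w)" by linarith
  qed
  then show ?case by simp
next
  case (Suc n)
  \<comment> \<open>The sign of the distinguished term commutes with that of the next draw, so the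
    induction hypothesis applies to the offsets \<open>h + \<psi> s\<close> and
    \<open>h - \<psi> s\<close>.\<close>
  have comm: "(\<lambda>z. h z + a z + b z) = (\<lambda>z. h z + b z + a z)" "(\<lambda>z. h z - a z + b z) = (\<lambda>z. h z + b z - a z)"
    "(\<lambda>z. h z - a z - b z) = (\<lambda>z. h z - b z - a z)" for a b
    by (auto simp: algebra_simps)
  let ?q = "\<lambda>a b s. rad_sup \<psi> n (\<lambda>z. h z + b s z + a z) + rad_sup \<psi> n (\<lambda>z. h z + b s z - a z)"
  let ?q' = "\<lambda>a b s. rad_sup \<psi> n (\<lambda>z. h z - b s z + a z) + rad_sup \<psi> n (\<lambda>z. h z - b s z - a z)"
  have eq: "rad_sup \<psi> (Suc n) (\<lambda>z. h z + a z) + rad_sup \<psi> (Suc n) (\<lambda>z. h z - a z)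
      = (\<Sum>s\<in>A. p s * ((?q a \<psi> s + ?q' a \<psi> s) / 2))" for a
    unfolding rad_sup.simps sum.distrib[symmetric]
    by (rule sum.cong)
      (simp_all add: comm(1)[of a] comm(2)[of a] comm(3)[of a] comm(2)[of _ a, symmetric] algebra_simps add_divide_distrib)
  show ?case unfolding eq
    using p_nonneg Suc.prems \<psi>
    by (intro sum_mono mult_left_mono divide_right_mono add_mono[OF Suc.IH Suc.IH]
        bounded_fun_on_add bounded_fun_on_diff) auto
qed

text \<open>The Ledoux--Talagrand principle: the induction hypothesis exchanges the functions of the
  later draws, the one-sign comparison that of the current draw.\<close>

lemma rad_sup_contraction:
  assumes \<phi>: "\<And>s. s \<in> A \<Longrightarrow> bounded_fun_on T (\<phi> s)" and \<psi>: "\<And>s. s \<in> A \<Longrightarrow> bounded_fun_on T (\<psi> s)"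
    and lip: "\<And>s z w. s \<in> A \<Longrightarrow> z \<in> T \<Longrightarrow> w \<in> T \<Longrightarrow> \<bar>\<phi> s z - \<phi> s w\<bar> \<le> \<bar>\<psi> s z - \<psi> s w\<bar>"
    and h: "bounded_fun_on T h"
  shows "rad_sup \<phi> n h \<le> rad_sup \<psi> n h"
  using h
proof (induction n arbitrary: h)
  case (Suc n)
  have "rad_sup \<phi> (Suc n) h \<le>
      (\<Sum>s\<in>A. p s * ((rad_sup \<psi> n (\<lambda>z. h z + \<phi> s z) + rad_sup \<psi> n (\<lambda>z. h z - \<phi> s z)) / 2))"
    unfolding rad_sup.simps using p_nonneg Suc.prems \<phi>
    by (intro sum_mono mult_left_mono divide_right_mono add_mono Suc.IH) auto
  also have "\<dots> \<le> rad_sup \<psi> (Suc n) h"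
    unfolding rad_sup.simps using p_nonneg Suc.prems \<phi> \<psi> lip
    by (intro sum_mono mult_left_mono divide_right_mono rad_sup_contract_one) auto
  finally show ?case .
qed simp

end

section \<open>Expectations over independent samples, one draw at a time\<close>

lemma expectation_Pi_pmf_lessThan_Suc:
  fixes F :: "(nat \<Rightarrow> 's) \<Rightarrow> real"
  assumes fin: "finite (set_pmf D)"
  shows "measure_pmf.expectation (Pi_pmf {..<Suc n} d (\<lambda>_. D)) F =
    (\<Sum>s\<in>set_pmf D. pmf D s * measure_pmf.expectation (Pi_pmf {..<n} d (\<lambda>_. D)) (\<lambda>S. F (S(n := s))))"
proof -
  have finP: "finite (set_pmf (Pi_pmf {..<n} d (\<lambda>_. D)))"
    using fin by (intro finite_subset[OF set_Pi_pmf_subset']) (auto intro!: finite_PiE_dflt)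
  have "Pi_pmf {..<Suc n} d (\<lambda>_. D) =
      map_pmf (\<lambda>(s, S). S(n := s)) (pair_pmf D (Pi_pmf {..<n} d (\<lambda>_. D)))"
    by (simp add: lessThan_Suc Pi_pmf_insert)
  also have "measure_pmf.expectation \<dots> F =
      measure_pmf.expectation (pair_pmf D (Pi_pmf {..<n} d (\<lambda>_. D))) (\<lambda>(s, S). F (S(n := s)))"
    by (simp add: case_prod_unfold)
  also have "\<dots> = (\<Sum>sS\<in>set_pmf D \<times> set_pmf (Pi_pmf {..<n} d (\<lambda>_. D)).
      pmf (pair_pmf D (Pi_pmf {..<n} d (\<lambda>_. D))) sS * (case sS of (s, S) \<Rightarrow> F (S(n := s))))"
    using fin finP by (subst integral_measure_pmf[of "set_pmf D \<times> set_pmf (Pi_pmf {..<n} d (\<lambda>_. D))"]) auto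
  also have "\<dots> = (\<Sum>s\<in>set_pmf D. \<Sum>S\<in>set_pmf (Pi_pmf {..<n} d (\<lambda>_. D)).
      pmf D s * (pmf (Pi_pmf {..<n} d (\<lambda>_. D)) S * F (S(n := s))))"
    unfolding sum.cartesian_product by (rule sum.cong) (auto simp: pmf_pair)
  also have "\<dots> = (\<Sum>s\<in>set_pmf D. pmf D s * measure_pmf.expectation (Pi_pmf {..<n} d (\<lambda>_. D)) (\<lambda>S. F (S(n := s))))"
    unfolding sum_distrib_left[symmetric] using finP
    by (subst integral_measure_pmf[of "set_pmf (Pi_pmf {..<n} d (\<lambda>_. D))"]) auto
  finally show ?thesis .
qed

text \<open>Ties the recursion to the actual sample: the contribution of draw \<open>n\<close> is
  moved into the offset.\<close>

lemma expectation_sup_eq_centered_sup: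
  fixes \<phi> :: "'s \<Rightarrow> 'z \<Rightarrow> real"
  assumes fin: "finite (set_pmf D)" and T: "T \<noteq> {}"
  defines "m \<equiv> \<lambda>z. \<Sum>t\<in>set_pmf D. pmf D t * \<phi> t z"
  shows "measure_pmf.expectation (Pi_pmf {..<n} d (\<lambda>_. D)) (\<lambda>S. SUP z\<in>T. h z + (\<Sum>i<n. m z - \<phi> (S i) z))
    = weighted_family.centered_sup T (set_pmf D) (pmf D) \<phi> n h"
proof -
  interpret weighted_family T "set_pmf D" "pmf D"
    by unfold_locales (use fin T sum_pmf_eq_1[OF fin order_refl] in auto)
  show ?thesis
  proof (induction n arbitrary: h)
    case (Suc n)
    have "(SUP z\<in>T. h z + (\<Sum>i<Suc n. m z - \<phi> ((S(n := s)) i) z)) =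
       (SUP z\<in>T. (h z + (m z - \<phi> s z)) + (\<Sum>i<n. m z - \<phi> (S i) z))" for S s
      by (simp add: algebra_simps)
    then show ?case
      by (subst expectation_Pi_pmf_lessThan_Suc[OF fin], simp only: Suc.IH)
         (simp only: centered_sup.simps m_def)
  qed simp
qed

section \<open>Rademacher complexity of the max-norm ball\<close>

text \<open>Hoeffding's lemma for a fair sign: parameter \<open>1/2\<close> and width
  \<open>2 * x\<close>, where the moment generating function is
  \<open>cosh x * exp x\<close>.\<close>

lemma cosh_le_exp_half_sq:
  fixes x :: real
  assumes "x \<ge> 0"
  shows "cosh x \<le> exp (x^2 / 2)"
proof -
  have pos: "1 + (1/2) * (exp (2*x) - 1) > 0"
    using exp_gt_zero[of "2*x"] by (simp add: algebra_simps add_pos_pos del: exp_gt_zero)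
  have "- (2*x) * (1/2) + ln (1 + (1/2) * (exp (2*x) - 1)) \<le> (2*x)^2 / 8"
    by (rule Hoeffdings_lemma_aux) (use assms in auto)
  then have "ln (1 + (1/2) * (exp (2*x) - 1)) \<le> x^2/2 + x" by (simp add: power_mult_distrib)
  then have "1 + (1/2) * (exp (2*x) - 1) \<le> exp (x^2/2 + x)" using pos by (metis exp_le_cancel_iff exp_ln)
  also have "1 + (1/2) * (exp (2*x) - 1) = cosh x * exp x"
    by (simp add: cosh_def field_simps exp_add[symmetric])
  finally show ?thesis by (simp add: exp_add)
qed

definition sign_form :: "nat \<Rightarrow> nat \<Rightarrow> (nat \<Rightarrow> nat \<Rightarrow> real) \<Rightarrow> (nat \<Rightarrow> real) \<Rightarrow> (nat \<Rightarrow> real) \<Rightarrow> real" where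
  "sign_form m1 m2 G x y = (\<Sum>a<m1. \<Sum>b<m2. G a b * x a * y b)"

definition signs :: "nat \<Rightarrow> (nat \<Rightarrow> real) set" where
  "signs m = {..<m} \<rightarrow>\<^sub>E {-1, 1}"

text \<open>A smooth substitute for the maximum over sign patterns; averaging over the sign of an
  added entry merely rescales it.\<close>

definition exp_sum :: "nat \<Rightarrow> nat \<Rightarrow> real \<Rightarrow> (nat \<Rightarrow> nat \<Rightarrow> real) \<Rightarrow> real" where
  "exp_sum m1 m2 l G = (\<Sum>x\<in>signs m1. \<Sum>y\<in>signs m2. exp (l * sign_form m1 m2 G x y))"

lemma finite_signs: "finite (signs m)"
  by (simp add: signs_def finite_PiE)

lemma card_signs: "card (signs m) = 2 ^ m"
  by (simp add: signs_def card_PiE numeral_2_eq_2)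

definition add_entry :: "nat \<times> nat \<Rightarrow> real \<Rightarrow> (nat \<Rightarrow> nat \<Rightarrow> real) \<Rightarrow> nat \<Rightarrow> nat \<Rightarrow> real" where
  "add_entry \<omega> c G a b = G a b + (if (a, b) = \<omega> then c else 0)"

lemma sum_add_entry:
  fixes f :: "nat \<Rightarrow> nat \<Rightarrow> real"
  assumes "\<omega> \<in> {..<m1} \<times> {..<m2}"
  shows "(\<Sum>a<m1. \<Sum>b<m2. add_entry \<omega> c G a b * f a b)
    = (\<Sum>a<m1. \<Sum>b<m2. G a b * f a b) + c * f (fst \<omega>) (snd \<omega>)"
proof -
  have "(\<Sum>a<m1. \<Sum>b<m2. (if (a, b) = \<omega> then c else 0) * f a b)
      = (\<Sum>ab\<in>{..<m1} \<times> {..<m2}. if ab = \<omega> then c * f (fst \<omega>) (snd \<omega>) else 0)"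
    unfolding sum.cartesian_product by (rule sum.cong) auto
  also have "\<dots> = c * f (fst \<omega>) (snd \<omega>)" using assms by (simp add: sum.delta)
  finally show ?thesis by (simp add: add_entry_def distrib_right sum.distrib)
qed

text \<open>At sign vectors the added entry shifts each exponent by \<open>c * l\<close> or its
  negative, so every summand acquires the same factor.\<close>

lemma exp_sum_add_entry:
  assumes \<omega>: "\<omega> \<in> {..<m1} \<times> {..<m2}"
  shows "exp_sum m1 m2 l (add_entry \<omega> c G) + exp_sum m1 m2 l (add_entry \<omega> (- c) G)
    = 2 * cosh (c * l) * exp_sum m1 m2 l G"
proof -
  have "exp (l * sign_form m1 m2 (add_entry \<omega> c G) x y) + exp (l * sign_form m1 m2 (add_entry \<omega> (- c) G) x y)
      = 2 * cosh (c * l) * exp (l * sign_form m1 m2 G x y)"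
    if xy: "x \<in> signs m1" "y \<in> signs m2" for x y
  proof -
    have sf: "sign_form m1 m2 (add_entry \<omega> e G) x y = sign_form m1 m2 G x y + e * (x (fst \<omega>) * y (snd \<omega>))" for e
      using sum_add_entry[OF \<omega>, of e G "\<lambda>a b. x a * y b"] by (simp add: sign_form_def mult_ac)
    have "x (fst \<omega>) \<in> {-1, 1}" "y (snd \<omega>) \<in> {-1, 1}" using xy \<omega> by (auto simp: signs_def PiE_def Pi_def)
    then have "x (fst \<omega>) * y (snd \<omega>) = 1 \<or> x (fst \<omega>) * y (snd \<omega>) = -1" by auto
    then show ?thesis unfolding sf
      by (elim disjE; simp only:) (simp_all add: cosh_def distrib_left exp_add field_simps exp_minus exp_diff)
  qed
  then show ?thesis
    by (simp add: exp_sum_def sum.distrib[symmetric] sum_distrib_left)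
qed

text \<open>Each draw adds an entry \<open>2\<close> or \<open>-2\<close> to \<open>G\<close>. The
  resulting factor \<open>cosh (2 * l)\<close> is the same at every index, so the weights sum out; a
  base bound affine in \<open>exp_sum\<close> survives this averaging.\<close>

lemma rad_sup_entries_le:
  fixes T :: "real mat set" and A :: "(bool \<times> (nat \<times> nat)) set"
  assumes wf: "weighted_family T A p" and A: "snd ` A \<subseteq> {..<m1} \<times> {..<m2}"
    and base: "\<And>G. (SUP Z\<in>T. \<Sum>a<m1. \<Sum>b<m2. G a b * Z $$ (a, b)) \<le> \<alpha> + \<beta> * exp_sum m1 m2 l G"
  shows "weighted_family.rad_sup T A p (\<lambda>s Z. 2 * Z $$ snd s) n (\<lambda>Z. \<Sum>a<m1. \<Sum>b<m2. G a b * Z $$ (a, b))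
    \<le> \<alpha> + \<beta> * cosh (2 * l) ^ n * exp_sum m1 m2 l G"
proof -
  interpret weighted_family T A p by (rule wf)
  show ?thesis
  proof (induction n arbitrary: G)
    case 0
    then show ?case using base by simp
  next
    case (Suc n)
    let ?h = "\<lambda>G Z. \<Sum>a<m1. \<Sum>b<m2. G a b * Z $$ (a, b)"
    let ?Q = "rad_sup (\<lambda>s Z. 2 * Z $$ snd s) n"
    let ?E = "exp_sum m1 m2 l"
    have step: "(?Q (\<lambda>Z. ?h G Z + 2 * Z $$ snd s) + ?Q (\<lambda>Z. ?h G Z - 2 * Z $$ snd s)) / 2
        \<le> \<alpha> + \<beta> * cosh (2 * l) ^ Suc n * ?E G" if "s \<in> A" for s
    proof -
      have \<omega>: "snd s \<in> {..<m1} \<times> {..<m2}" using A that by blast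
      have e: "?h G Z + c * Z $$ snd s = ?h (add_entry (snd s) c G) Z" for c and Z :: "real mat"
        using sum_add_entry[OF \<omega>, of c G "\<lambda>a b. Z $$ (a, b)"] by simp
      have "?Q (\<lambda>Z. ?h G Z + 2 * Z $$ snd s) + ?Q (\<lambda>Z. ?h G Z - 2 * Z $$ snd s) =
          ?Q (?h (add_entry (snd s) 2 G)) + ?Q (?h (add_entry (snd s) (-2) G))"
        using e[of _ 2] e[of _ "-2"] by simp
      also have "\<dots> \<le> (\<alpha> + \<beta> * cosh (2 * l) ^ n * ?E (add_entry (snd s) 2 G))
          + (\<alpha> + \<beta> * cosh (2 * l) ^ n * ?E (add_entry (snd s) (-2) G))"
        by (intro add_mono Suc.IH)
      also have "\<dots> = 2 * \<alpha> + \<beta> * cosh (2 * l) ^ n * (?E (add_entry (snd s) 2 G) + ?E (add_entry (snd s) (-2) G))"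
        by (simp add: algebra_simps)
      also have "\<dots> = 2 * (\<alpha> + \<beta> * cosh (2 * l) ^ Suc n * ?E G)"
        unfolding exp_sum_add_entry[OF \<omega>] by (simp add: algebra_simps)
      finally show ?thesis by simp
    qed
    have "rad_sup (\<lambda>s Z. 2 * Z $$ snd s) (Suc n) (?h G) \<le> (\<Sum>s\<in>A. p s * (\<alpha> + \<beta> * cosh (2 * l) ^ Suc n * ?E G))"
      unfolding rad_sup.simps using step p_nonneg by (intro sum_mono mult_left_mono) auto
    also have "\<dots> = \<alpha> + \<beta> * cosh (2 * l) ^ Suc n * ?E G"
      by (simp only: sum_distrib_right[symmetric] p_sum mult_1)
    finally show ?case .
  qed
qed

lemma gamma2_dual_nonneg: "gamma2_dual m1 m2 G \<ge> 0"
  using vec_bilinear_le_gamma2_dual_unit[of m1 0 "\<lambda>_ _. 0" m2 "\<lambda>_ _. 0" G]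
  by (simp add: rows_le_def vec_bilinear_def)

lemma rows_le_two_inf_norm:
  assumes "U \<in> carrier_mat m k"
  shows "rows_le m k (\<lambda>a i. U $$ (a, i)) (two_inf_norm U)"
  unfolding rows_le_def
proof safe
  fix a assume "a < m"
  then have "sqrt (\<Sum>i<k. (U $$ (a, i))^2) \<le> two_inf_norm U"
    unfolding two_inf_norm_def using assms by (intro Max_ge) auto
  then show "(\<Sum>i<k. (U $$ (a, i))^2) \<le> (two_inf_norm U)^2"
    by (metis real_sqrt_le_iff sqrt_le_D)
qed

text \<open>Duality, applied to an almost optimal factorization because \<open>max_norm\<close> is
  an infimum. The slack \<open>e / (g + 1)\<close> costs at most \<open>e\<close>, also when
  \<open>g = 0\<close>.\<close>

lemma inner_le_max_norm_gamma2_dual: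
  fixes Z :: "real mat"
  assumes Z: "Z \<in> carrier_mat m1 m2" and m: "m1 \<ge> 1" "m2 \<ge> 1" and B: "max_norm Z \<le> B"
  shows "(\<Sum>a<m1. \<Sum>b<m2. G a b * Z $$ (a, b)) \<le> B * gamma2_dual m1 m2 G"
proof (rule field_le_epsilon)
  fix e :: real assume e: "e > 0"
  define g where "g = gamma2_dual m1 m2 G"
  have g: "g \<ge> 0" by (simp add: g_def gamma2_dual_nonneg)
  define N where "N = {two_inf_norm U * two_inf_norm V | U V k.
      U \<in> carrier_mat (dim_row Z) k \<and> V \<in> carrier_mat (dim_col Z) k \<and> Z = U * V\<^sup>T}"
  \<comment> \<open>The trivial factorization shows that the infimum is over a nonempty set.\<close>
  have "Z = Z * (1\<^sub>m m2)\<^sup>T" using Z by simp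
  then have "two_inf_norm Z * two_inf_norm (1\<^sub>m m2) \<in> N"
    unfolding N_def using Z by (intro CollectI exI[of _ Z] exI[of _ "1\<^sub>m m2"] exI[of _ m2]) auto
  moreover have "Inf N < B + e / (g + 1)"
    using B e g unfolding max_norm_def N_def[symmetric] by (smt (verit) divide_pos_pos)
  ultimately obtain x where "x \<in> N" "x < B + e / (g + 1)" using cInf_lessD by blast
  then obtain U V k where U: "U \<in> carrier_mat m1 k" and V: "V \<in> carrier_mat m2 k" and ZUV: "Z = U * V\<^sup>T"
    and lt: "two_inf_norm U * two_inf_norm V < B + e / (g + 1)"
    using Z unfolding N_def by auto
  have ent: "Z $$ (a, b) = (\<Sum>i<k. U $$ (a, i) * V $$ (b, i))" if "a < m1" "b < m2" for a b
    using that U V by (simp add: ZUV scalar_prod_def lessThan_atLeast0)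
  have nn: "two_inf_norm U \<ge> 0" "two_inf_norm V \<ge> 0"
    using U V m by (auto intro: two_inf_norm_nonneg)
  have "(\<Sum>a<m1. \<Sum>b<m2. G a b * Z $$ (a, b)) =
      vec_bilinear m1 m2 G k (\<lambda>a i. U $$ (a, i)) (\<lambda>b i. V $$ (b, i))"
    unfolding vec_bilinear_def by (intro sum.cong) (auto simp: ent)
  also have "\<dots> \<le> two_inf_norm U * two_inf_norm V * g" unfolding g_def
    by (intro vec_bilinear_le_gamma2_dual rows_le_two_inf_norm U V nn)
  also have "\<dots> \<le> (B + e / (g + 1)) * g" using lt g by (intro mult_right_mono) auto
  also have "\<dots> \<le> B * g + e" using g e by (simp add: field_simps)
  finally show "(\<Sum>a<m1. \<Sum>b<m2. G a b * Z $$ (a, b)) \<le> B * gamma2_dual m1 m2 G + e"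
    by (simp add: g_def)
qed

text \<open>Massart's finite class argument for the \<open>2 ^ d\<close> sign patterns, in the form
  \<open>l * t \<le> c - 1 + exp (l * t - c)\<close>, which stays linear in the exponentials.\<close>

lemma gamma2_dual_le_exp_sum:
  assumes "l > 0"
  shows "gamma2_dual m1 m2 G \<le> 8 * ((c - 1 + exp (- c) * exp_sum m1 m2 l G) / l)"
proof (rule grothendieck_inequality)
  fix x y assume "x \<in> {..<m1} \<rightarrow>\<^sub>E {-1, 1::real}" "y \<in> {..<m2} \<rightarrow>\<^sub>E {-1, 1::real}"
  then have xy: "x \<in> signs m1" "y \<in> signs m2" by (auto simp: signs_def)
  have "exp (l * sign_form m1 m2 G x y) \<le> (\<Sum>y\<in>signs m2. exp (l * sign_form m1 m2 G x y))"
    by (rule member_le_sum[OF xy(2)]) (auto simp: finite_signs)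
  also have "\<dots> \<le> exp_sum m1 m2 l G" unfolding exp_sum_def
    by (rule member_le_sum[OF xy(1)]) (auto simp: finite_signs sum_nonneg)
  finally have le: "exp (l * sign_form m1 m2 G x y) \<le> exp_sum m1 m2 l G" .
  have "l * sign_form m1 m2 G x y \<le> c - 1 + exp (l * sign_form m1 m2 G x y - c)"
    using exp_ge_add_one_self[of "l * sign_form m1 m2 G x y - c"] by linarith
  also have "\<dots> = c - 1 + exp (- c) * exp (l * sign_form m1 m2 G x y)"
    by (simp add: exp_add[symmetric])
  also have "\<dots> \<le> c - 1 + exp (- c) * exp_sum m1 m2 l G" using le by simp
  finally show "(\<Sum>a<m1. \<Sum>b<m2. G a b * x a * y b) \<le> (c - 1 + exp (- c) * exp_sum m1 m2 l G) / l"
    using assms by (simp add: sign_form_def field_simps)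
qed

lemma rad_sup_max_norm_ball:
  fixes T :: "real mat set" and A :: "(bool \<times> (nat \<times> nat)) set"
  assumes wf: "weighted_family T A p" and A: "snd ` A \<subseteq> {..<m1} \<times> {..<m2}"
    and m: "m1 \<ge> 1" "m2 \<ge> 1" and n: "n \<ge> 1" and B: "B \<ge> 0"
    and T: "T \<subseteq> carrier_mat m1 m2" "\<And>Z. Z \<in> T \<Longrightarrow> max_norm Z \<le> B"
  shows "weighted_family.rad_sup T A p (\<lambda>s Z. 2 * Z $$ snd s) n (\<lambda>_. 0)
    \<le> 24 * B * sqrt (real (m1 + m2) * real n)"
proof -
  interpret weighted_family T A p by (rule wf)
  define d where "d = real (m1 + m2)"
  \<comment> \<open>With this \<open>l\<close> both contributions to \<open>c\<close> have order
    \<open>d\<close>: at most \<open>d\<close> from the number of sign pairs and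
    \<open>2 * n * l^2 = 2 * d\<close> from the \<open>n\<close> factors
    \<open>cosh (2 * l)\<close>.\<close>
  define l where "l = sqrt (d / n)"
  \<comment> \<open>The exponential sum after \<open>n\<close> draws from zero is exactly
    \<open>exp c\<close>; hence \<open>c - 1 + exp (- c) * exp c\<close> collapses to
    \<open>c\<close>.\<close>
  define c where "c = ln (2 ^ (m1 + m2) * cosh (2 * l) ^ n)"
  have d: "d > 0" using m by (simp add: d_def)
  have l: "l > 0" "l^2 = d / n" using d n by (auto simp: l_def)
  have cpos: "2 ^ (m1 + m2) * cosh (2 * l) ^ n > (0::real)" by (simp add: cosh_real_pos)
  have "c = (m1 + m2) * ln 2 + n * ln (cosh (2 * l))"
    by (simp add: c_def ln_mult ln_realpow cosh_real_pos)
  also have "\<dots> \<le> d * 1 + n * (2 * l^2)"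
  proof (intro add_mono mult_left_mono)
    show "real (m1 + m2) * ln 2 \<le> d * 1" unfolding d_def using ln_2_less_1 by (intro mult_left_mono) auto
    have "ln (cosh (2 * l)) \<le> ln (exp ((2 * l)^2 / 2))"
      using cosh_le_exp_half_sq[of "2 * l"] l by (subst ln_le_cancel_iff) (auto simp: cosh_real_pos)
    then show "ln (cosh (2 * l)) \<le> 2 * l^2" by (simp add: power_mult_distrib)
  qed auto
  also have "\<dots> = 3 * d" using n l by simp
  finally have c3: "c \<le> 3 * d" .
  have "(SUP Z\<in>T. \<Sum>a<m1. \<Sum>b<m2. G a b * Z $$ (a, b))
      \<le> 8 * B * (c - 1) / l + (8 * B * exp (- c) / l) * exp_sum m1 m2 l G" for G
  proof (rule cSUP_least[OF T_ne])
    fix Z assume "Z \<in> T"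
    then have "(\<Sum>a<m1. \<Sum>b<m2. G a b * Z $$ (a, b)) \<le> B * gamma2_dual m1 m2 G"
      using T m by (intro inner_le_max_norm_gamma2_dual) auto
    also have "\<dots> \<le> B * (8 * ((c - 1 + exp (- c) * exp_sum m1 m2 l G) / l))"
      using B l by (intro mult_left_mono gamma2_dual_le_exp_sum)
    also have "\<dots> = 8 * B * (c - 1) / l + (8 * B * exp (- c) / l) * exp_sum m1 m2 l G"
      by (simp add: algebra_simps add_divide_distrib diff_divide_distrib)
    finally show "(\<Sum>a<m1. \<Sum>b<m2. G a b * Z $$ (a, b))
      \<le> 8 * B * (c - 1) / l + (8 * B * exp (- c) / l) * exp_sum m1 m2 l G" .
  qed
  then have "rad_sup (\<lambda>s Z. 2 * Z $$ snd s) n (\<lambda>Z. \<Sum>a<m1. \<Sum>b<m2. 0 * Z $$ (a, b))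
      \<le> 8 * B * (c - 1) / l + (8 * B * exp (- c) / l) * cosh (2 * l) ^ n * exp_sum m1 m2 l (\<lambda>_ _. 0)"
    by (rule rad_sup_entries_le[OF wf A])
  also have "exp_sum m1 m2 l (\<lambda>_ _. 0) = 2 ^ (m1 + m2)"
    by (simp add: exp_sum_def sign_form_def card_signs power_add)
  also have "(8 * B * exp (- c) / l) * cosh (2 * l) ^ n * 2 ^ (m1 + m2)
      = 8 * B / l * (exp (- c) * (2 ^ (m1 + m2) * cosh (2 * l) ^ n))" by simp
  also have "2 ^ (m1 + m2) * cosh (2 * l) ^ n = exp c" using cpos by (simp add: c_def)
  also have "8 * B * (c - 1) / l + 8 * B / l * (exp (- c) * exp c) = 8 * B * c / l"
    by (simp add: exp_add[symmetric] algebra_simps diff_divide_distrib)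
  \<comment> \<open>The final 24 is the 8 of Grothendieck's inequality times the 3 of
    \<open>c3\<close>.\<close>
  also have "\<dots> \<le> 8 * B * (3 * d) / l"
    using B c3 l by (intro divide_right_mono mult_left_mono) auto
  also have "\<dots> = 24 * B * (d / l)" by simp
  also have "d / l = sqrt (d * n)"
  proof -
    have "d / l = (sqrt d * sqrt d) * sqrt n / sqrt d" using d by (simp add: l_def real_sqrt_divide)
    also have "\<dots> = sqrt d * sqrt n" using d by (simp add: divide_simps)
    finally show ?thesis by (simp add: real_sqrt_mult)
  qed
  finally show ?thesis by (simp add: d_def)
qed

section \<open>Log-loss and excess risk\<close>

lemma logistic_pos: "logistic x > 0"
  by (simp add: logistic_def add_pos_pos)

lemma one_minus_logistic: "1 - logistic x = logistic (- x)"
proof -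
  have "1 + exp x > 0" "1 + exp (- x) > 0" by (simp_all add: add_pos_pos)
  then show ?thesis by (simp add: logistic_def field_simps exp_minus)
qed

lemma logistic_less_1: "logistic x < 1"
  using logistic_pos[of "- x"] one_minus_logistic[of x] by linarith

lemma logistic_ge_half_iff: "logistic x \<ge> 1 / 2 \<longleftrightarrow> x \<ge> 0"
proof -
  have "1 + exp x > 0" by (simp add: add_pos_pos)
  then have "logistic x \<ge> 1 / 2 \<longleftrightarrow> exp x \<ge> exp 0"
    unfolding logistic_def by (subst pos_le_divide_eq) (auto simp del: exp_le_cancel_iff)
  then show ?thesis by (simp only: exp_le_cancel_iff)
qed

text \<open>In \<open>x - ln (1 + exp x)\<close> the subtracted term increases, but by no more than
  \<open>x\<close> does.\<close>

lemma ln_logistic_lipschitz: "\<bar>ln (logistic x) - ln (logistic y)\<bar> \<le> \<bar>x - y\<bar>"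
proof -
  have pos: "1 + exp x > 0" for x :: real by (simp add: add_pos_pos)
  have eq: "ln (logistic x) = x - ln (1 + exp x)" for x
    unfolding logistic_def using ln_divide_pos[OF exp_gt_zero pos] by simp
  have mono: "ln (1 + exp x) \<le> ln (1 + exp y)" if "x \<le> y" for x y :: real
    using that by (subst ln_le_cancel_iff) (auto simp: add_pos_pos)
  have up: "ln (1 + exp y) \<le> (y - x) + ln (1 + exp x)" if "x \<le> y" for x y :: real
  proof -
    have "1 + exp y \<le> exp (y - x) * (1 + exp x)"
      using that by (simp add: distrib_left exp_add[symmetric])
    then have "ln (1 + exp y) \<le> ln (exp (y - x) * (1 + exp x))"
      by (subst ln_le_cancel_iff) (auto simp: add_pos_pos)
    also have "\<dots> = (y - x) + ln (1 + exp x)" using ln_mult_pos[OF exp_gt_zero pos] by simp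
    finally show ?thesis .
  qed
  have le: "\<bar>ln (logistic x) - ln (logistic y)\<bar> \<le> y - x" if "x \<le> y" for x y
    unfolding eq using mono[OF that] up[OF that] by linarith
  show ?thesis
  proof (cases "x \<le> y")
    case True
    then show ?thesis using le[of x y] by linarith
  next
    case False
    then show ?thesis using le[of y x] by linarith
  qed
qed

text \<open>As a function of \<open>t\<close>, \<open>H\<close> has derivative
  \<open>(t - p) * (1 / (t * (1 - t)) - 4)\<close>. The second factor is nonnegative since
  \<open>t * (1 - t) \<le> 1/4\<close>, so \<open>H\<close> is minimal at
  \<open>t = p\<close>.\<close>

lemma pinsker_binary:
  fixes p q :: real
  assumes p: "0 < p" "p < 1" and q: "0 < q" "q < 1"
  shows "2 * (p - q)^2 \<le> (p * - ln q + (1 - p) * - ln (1 - q)) - (p * - ln p + (1 - p) * - ln (1 - p))"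
proof -
  define H where "H t = p * - ln t + (1 - p) * - ln (1 - t) - 2 * (p - t)^2" for t
  have der: "(H has_real_derivative (t - p) * (1 / (t * (1 - t)) - 4)) (at t)" if "0 < t" "t < 1" for t
    unfolding H_def using that
    by (auto intro!: derivative_eq_intros simp: divide_simps power2_eq_square) (simp add: algebra_simps)
  have pos: "1 / (t * (1 - t)) - 4 \<ge> 0" if "0 < t" "t < 1" for t :: real
  proof -
    have "4 * (t * (1 - t)) \<le> 1" using zero_le_power2[of "2 * t - 1"] by (simp add: power2_eq_square algebra_simps)
    then show ?thesis using that by (simp add: field_simps)
  qed
  have "H p \<le> H q"
  proof (cases "p \<le> q")
    case True
    show ?thesis
    proof (rule DERIV_nonneg_imp_nondecreasing[OF True])
      fix t assume t: "p \<le> t" "t \<le> q"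
      then have t01: "0 < t" "t < 1" using p q by auto
      show "\<exists>y. (H has_real_derivative y) (at t) \<and> 0 \<le> y"
        using der[OF t01] mult_nonneg_nonneg[OF _ pos[OF t01], of "t - p"] t by auto
    qed
  next
    case False
    show ?thesis
    proof (rule DERIV_nonpos_imp_nonincreasing[of q p H])
      show "q \<le> p" using False by simp
      fix t assume t: "q \<le> t" "t \<le> p"
      then have t01: "0 < t" "t < 1" using p q by auto
      show "\<exists>y. (H has_real_derivative y) (at t) \<and> y \<le> 0"
        using der[OF t01] mult_nonpos_nonneg[OF _ pos[OF t01], of "t - p"] t by auto
    qed
  qed
  then show ?thesis by (simp add: H_def)
qed

section \<open>Log-loss and risk as averages over the entries\<close>

definition log_loss :: "bool \<times> (nat \<times> nat) \<Rightarrow> real mat \<Rightarrow> real" where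
  "log_loss s Z = (if fst s then - ln (logistic (Z $$ snd s)) else - ln (1 - logistic (Z $$ snd s)))"

lemma loglik_eq_log_loss: "loglik n S Z = - (\<Sum>i<n. log_loss (S i) Z)"
  unfolding loglik_def sum_negf[symmetric] by (rule sum.cong) (auto simp: log_loss_def)

lemma log_loss_lipschitz: "\<bar>log_loss s Z - log_loss s W\<bar> \<le> \<bar>Z $$ snd s - W $$ snd s\<bar>"
  using ln_logistic_lipschitz[of "Z $$ snd s" "W $$ snd s"]
    ln_logistic_lipschitz[of "- Z $$ snd s" "- W $$ snd s"]
  by (auto simp: log_loss_def one_minus_logistic)

lemma expectation_draw_pmf:
  fixes g :: "bool \<times> (nat \<times> nat) \<Rightarrow> real"
  assumes X: "X \<in> carrier_mat m1 m2" and m: "m1 \<ge> 1" "m2 \<ge> 1"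
  shows "measure_pmf.expectation (draw_pmf X) g = (\<Sum>\<omega>\<in>{..<m1} \<times> {..<m2}.
    (logistic (X $$ \<omega>) * g (True, \<omega>) + (1 - logistic (X $$ \<omega>)) * g (False, \<omega>))) / (real m1 * real m2)"
proof -
  let ?G = "{..<m1} \<times> {..<m2}"
  have ne: "?G \<noteq> {}" using m by (auto simp: lessThan_empty_iff)
  have inner: "measure_pmf.expectation (bernoulli_pmf (logistic (X $$ \<omega>)) \<bind> (\<lambda>y. return_pmf (y, \<omega>))) g
    = logistic (X $$ \<omega>) * g (True, \<omega>) + (1 - logistic (X $$ \<omega>)) * g (False, \<omega>)" for \<omega>
    using logistic_pos[of "X $$ \<omega>"] logistic_less_1[of "X $$ \<omega>"]
    by (simp add: map_pmf_def[symmetric] less_imp_le)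
  have "measure_pmf.expectation (draw_pmf X) g =
     (\<Sum>\<omega>\<in>?G. measure_pmf.expectation (bernoulli_pmf (logistic (X $$ \<omega>)) \<bind> (\<lambda>y. return_pmf (y, \<omega>))) g / real (card ?G))"
    unfolding draw_pmf_def using X ne
    by (subst pmf_expectation_bind_pmf_of_set) (auto simp: divide_inverse mult_ac)
  then show ?thesis unfolding inner by (simp add: sum_divide_distrib[symmetric])
qed

lemma set_draw_pmf:
  assumes X: "X \<in> carrier_mat m1 m2" and m: "m1 \<ge> 1" "m2 \<ge> 1"
  shows "set_pmf (draw_pmf X) \<subseteq> UNIV \<times> ({..<m1} \<times> {..<m2})"
proof -
  have "{..<m1} \<times> {..<m2} \<noteq> {}" using m by (auto simp: lessThan_empty_iff)
  then show ?thesis using X by (auto simp: draw_pmf_def)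
qed

lemma risk_eq:
  assumes X: "X \<in> carrier_mat m1 m2" and m: "m1 \<ge> 1" "m2 \<ge> 1"
  shows "risk X \<eta> = (\<Sum>\<omega>\<in>{..<m1} \<times> {..<m2}.
    if \<eta> \<omega> then 1 - logistic (X $$ \<omega>) else logistic (X $$ \<omega>)) / (real m1 * real m2)"
proof -
  have "risk X \<eta> = measure_pmf.expectation (draw_pmf X) (indicator {(y, \<omega>). y \<noteq> \<eta> \<omega>})"
    by (simp add: risk_def)
  also have "\<dots> = (\<Sum>\<omega>\<in>{..<m1} \<times> {..<m2}.
    if \<eta> \<omega> then 1 - logistic (X $$ \<omega>) else logistic (X $$ \<omega>)) / (real m1 * real m2)"
    unfolding expectation_draw_pmf[OF assms]
    by (intro arg_cong2[where f="(/)"] sum.cong) auto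
  finally show ?thesis .
qed

text \<open>The free parameter \<open>t\<close> comes from AM-GM in the form
  \<open>2 * \<delta> \<le> 2 * \<delta>^2 / t + t / 2\<close>. It keeps the bound affine in the
  Kullback--Leibler risk, so expectations over the sample can be taken before \<open>t\<close> is
  optimised.\<close>

lemma risk_excess_le:
  assumes X: "X \<in> carrier_mat m1 m2" and m: "m1 \<ge> 1" "m2 \<ge> 1" and t: "t > 0"
  shows "risk X (plugin Z) - risk X (plugin X) \<le>
    (measure_pmf.expectation (draw_pmf X) (\<lambda>s. log_loss s Z)
      - measure_pmf.expectation (draw_pmf X) (\<lambda>s. log_loss s X)) / t + t / 2"
proof -
  let ?G = "{..<m1} \<times> {..<m2}"
  let ?f = "\<lambda>\<omega>. logistic (X $$ \<omega>)" and ?g = "\<lambda>\<omega>. logistic (Z $$ \<omega>)"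
  let ?r = "\<lambda>W \<omega>. if plugin W \<omega> then 1 - ?f \<omega> else ?f \<omega>"
  let ?k = "\<lambda>\<omega>. (?f \<omega> * - ln (?g \<omega>) + (1 - ?f \<omega>) * - ln (1 - ?g \<omega>))
      - (?f \<omega> * - ln (?f \<omega>) + (1 - ?f \<omega>) * - ln (1 - ?f \<omega>))"
  have N: "real m1 * real m2 > 0" using m by simp
  have pt: "?r Z \<omega> - ?r X \<omega> \<le> ?k \<omega> / t + t / 2" for \<omega>
  proof -
    define \<delta> where "\<delta> = \<bar>?f \<omega> - ?g \<omega>\<bar>"
    have "?r Z \<omega> - ?r X \<omega> \<le> 2 * \<delta>"
      using logistic_ge_half_iff[of "X $$ \<omega>"] logistic_ge_half_iff[of "Z $$ \<omega>"]
      by (auto simp: plugin_def \<delta>_def)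
    also have "\<dots> \<le> 2 * \<delta>^2 / t + t / 2"
    proof -
      have "0 \<le> (2 * \<delta> - t)^2 / (2 * t)" using t by simp
      also have "\<dots> = 2 * \<delta>^2 / t + t / 2 - 2 * \<delta>"
        using t by (simp add: power2_eq_square field_simps)
      finally show ?thesis by simp
    qed
    also have "2 * \<delta>^2 \<le> ?k \<omega>"
      using pinsker_binary[of "?f \<omega>" "?g \<omega>"] logistic_pos logistic_less_1 by (simp add: \<delta>_def)
    finally show ?thesis using t by (simp add: divide_right_mono)
  qed
  have "risk X (plugin Z) - risk X (plugin X) = (\<Sum>\<omega>\<in>?G. ?r Z \<omega> - ?r X \<omega>) / (real m1 * real m2)"
    unfolding risk_eq[OF X m] by (simp only: sum_subtractf diff_divide_distrib)
  also have "\<dots> \<le> (\<Sum>\<omega>\<in>?G. ?k \<omega> / t + t / 2) / (real m1 * real m2)"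
    using N by (intro divide_right_mono sum_mono pt) auto
  also have "\<dots> = ((\<Sum>\<omega>\<in>?G. ?k \<omega>) / (real m1 * real m2)) / t + t / 2"
    unfolding sum.distrib using m by (simp add: sum_divide_distrib[symmetric] add_divide_distrib)
  also have "(\<Sum>\<omega>\<in>?G. ?k \<omega>) / (real m1 * real m2) =
     measure_pmf.expectation (draw_pmf X) (\<lambda>s. log_loss s Z) - measure_pmf.expectation (draw_pmf X) (\<lambda>s. log_loss s X)"
    unfolding expectation_draw_pmf[OF X m] sum_subtractf diff_divide_distrib by (simp add: log_loss_def)
  finally show ?thesis .
qed

section \<open>Expected log-loss of the maximum likelihood estimator\<close>

lemma expectation_mono_finite_pmf:
  fixes f g :: "'a \<Rightarrow> real"
  assumes "finite (set_pmf M)" "\<And>x. x \<in> set_pmf M \<Longrightarrow> f x \<le> g x"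
  shows "measure_pmf.expectation M f \<le> measure_pmf.expectation M g"
  using assms by (intro integral_mono_AE integrable_measure_pmf_finite) (auto simp: AE_measure_pmf_iff)

text \<open>The excess, multiplied by \<open>n\<close>, splits into the deviation at the estimator,
  bounded by the uniform \<open>U\<close>, the deviation \<open>V\<close> at the fixed matrix
  \<open>X\<close>, which has mean zero, and a difference of empirical losses that is at most zero
  by maximality.\<close>

lemma expected_log_loss_excess_le:
  fixes T :: "real mat set"
  assumes X: "X \<in> carrier_mat m1 m2" and m: "m1 \<ge> 1" "m2 \<ge> 1" and n: "n \<ge> 1" and B: "B \<ge> 0"
    and T: "T \<subseteq> carrier_mat m1 m2" "\<And>Z. Z \<in> T \<Longrightarrow> max_norm Z \<le> B" "\<And>Z. Z \<in> T \<Longrightarrow> sup_norm Z \<le> \<gamma>"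
    and XT: "X \<in> T"
    and mle: "\<And>S. S \<in> set_pmf (sample_pmf n X) \<Longrightarrow> Xhat S \<in> T"
      "\<And>S Z. S \<in> set_pmf (sample_pmf n X) \<Longrightarrow> Z \<in> T \<Longrightarrow> loglik n S Z \<le> loglik n S (Xhat S)"
  defines "L \<equiv> \<lambda>Z. measure_pmf.expectation (draw_pmf X) (\<lambda>s. log_loss s Z)"
  shows "measure_pmf.expectation (sample_pmf n X) (\<lambda>S. L (Xhat S) - L X) \<le> 24 * B * sqrt (real (m1 + m2) / n)"
proof -
  define D where "D = draw_pmf X"
  define P where "P = sample_pmf n X"
  have sub: "set_pmf D \<subseteq> UNIV \<times> ({..<m1} \<times> {..<m2})" unfolding D_def by (rule set_draw_pmf[OF X m])
  then have finD: "finite (set_pmf D)" by (rule finite_subset) auto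
  have P_eq: "P = Pi_pmf {..<n} (True, (0, 0)) (\<lambda>_. D)" by (simp add: P_def sample_pmf_def D_def)
  have finP: "finite (set_pmf P)" unfolding P_eq
    using finD by (intro finite_subset[OF set_Pi_pmf_subset']) (auto intro!: finite_PiE_dflt)
  have int: "integrable P f" for f :: "_ \<Rightarrow> real" using finP by (rule integrable_measure_pmf_finite)
  have T_ne: "T \<noteq> {}" using XT by blast
  have wf: "weighted_family T (set_pmf D) (pmf D)"
    by unfold_locales (use finD T_ne sum_pmf_eq_1[OF finD order_refl] in auto)
  interpret weighted_family T "set_pmf D" "pmf D" by (rule wf)
  have L: "L Z = (\<Sum>s\<in>set_pmf D. pmf D s * log_loss s Z)" for Z
    unfolding L_def D_def[symmetric] using finD by (subst integral_measure_pmf[of "set_pmf D"]) auto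
  have entry: "\<bar>Z $$ snd s\<bar> \<le> \<gamma>" if "s \<in> set_pmf D" "Z \<in> T" for s Z
  proof -
    have "fst (snd s) < m1" "snd (snd s) < m2" using sub that by auto
    moreover have "Z \<in> carrier_mat m1 m2" using T that by blast
    ultimately show ?thesis using abs_index_le_sup_norm[of "fst (snd s)" Z "snd (snd s)"] T(3)[OF that(2)] by simp
  qed
  have b1: "bounded_fun_on T (\<lambda>Z. Z $$ snd s)" if "s \<in> set_pmf D" for s
    using entry[OF that] unfolding bounded_fun_on_def by blast
  have b2: "bounded_fun_on T (log_loss s)" if s: "s \<in> set_pmf D" for s
    unfolding bounded_fun_on_def
  proof (intro exI ballI)
    fix Z assume "Z \<in> T"
    then show "\<bar>log_loss s Z\<bar> \<le> \<bar>log_loss s X\<bar> + 2 * \<gamma>"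
      using log_loss_lipschitz[of s Z X] entry[OF s, of Z] entry[OF s XT] by linarith
  qed
  have b0: "bounded_fun_on T (\<lambda>_. 0)" by (auto simp: bounded_fun_on_def)
  \<comment> \<open>The leading \<open>0 +\<close> is the zero offset in
    \<open>centered_sup\<close>.\<close>
  define U where "U S = (SUP Z\<in>T. 0 + (\<Sum>i<n. (\<Sum>s\<in>set_pmf D. pmf D s * log_loss s Z) - log_loss (S i) Z))" for S
  define V where "V S = (\<Sum>i<n. log_loss (S i) X) - n * L X" for S
  have "measure_pmf.expectation P U = centered_sup log_loss n (\<lambda>_. 0)"
    unfolding U_def P_eq by (rule expectation_sup_eq_centered_sup[OF finD T_ne])
  also have "\<dots> \<le> rad_sup (\<lambda>s Z. 2 * log_loss s Z) n (\<lambda>_. 0)" by (rule symmetrization[OF b2 b0])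
  also have "\<dots> \<le> rad_sup (\<lambda>s Z. 2 * Z $$ snd s) n (\<lambda>_. 0)"
  proof (rule rad_sup_contraction)
    show "\<bar>2 * log_loss s Z - 2 * log_loss s W\<bar> \<le> \<bar>2 * Z $$ snd s - 2 * W $$ snd s\<bar>" for s Z W
      using log_loss_lipschitz[of s Z W] by linarith
  qed (auto intro: bounded_fun_on_cmult b0 b1 b2)
  also have "\<dots> \<le> 24 * B * sqrt (real (m1 + m2) * real n)"
    using sub m n B T by (intro rad_sup_max_norm_ball[OF wf]) auto
  finally have EU: "measure_pmf.expectation P U \<le> 24 * B * sqrt (real (m1 + m2) * real n)" .
  have EV: "measure_pmf.expectation P V = 0"
  proof -
    have "measure_pmf.expectation P (\<lambda>S. log_loss (S i) X) = L X" if "i < n" for i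
    proof -
      have "map_pmf (\<lambda>S. S i) P = D" unfolding P_eq using that by (simp add: Pi_pmf_component)
      then have "measure_pmf.expectation D (\<lambda>s. log_loss s X) =
          measure_pmf.expectation (map_pmf (\<lambda>S. S i) P) (\<lambda>s. log_loss s X)" by (simp only:)
      then have "measure_pmf.expectation D (\<lambda>s. log_loss s X) = measure_pmf.expectation P (\<lambda>S. log_loss (S i) X)"
        by (simp only: integral_map_pmf)
      then show ?thesis by (simp add: L_def D_def)
    qed
    then show ?thesis unfolding V_def by (simp add: int)
  qed
  have pt: "n * (L (Xhat S) - L X) \<le> U S + V S" if S: "S \<in> set_pmf P" for S
  proof -
    have XhT: "Xhat S \<in> T" using mle(1) S by (simp add: P_def)
    have Si: "S i \<in> set_pmf D" if "i < n" for i
    proof -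
      have "map_pmf (\<lambda>S. S i) P = D" unfolding P_eq using that by (simp add: Pi_pmf_component)
      then show ?thesis using S by (metis imageI set_map_pmf)
    qed
    have "bounded_fun_on T (\<lambda>Z. 0 + (\<Sum>i<n. (\<Sum>s\<in>set_pmf D. pmf D s * log_loss s Z) - log_loss (S i) Z))"
      using b0 b2 Si
      by (intro bounded_fun_on_add bounded_fun_on_sum bounded_fun_on_diff bounded_fun_on_cmult) auto
    from bounded_fun_on_upper[OF this XhT]
    have "(\<Sum>i<n. L (Xhat S) - log_loss (S i) (Xhat S)) \<le> U S" by (simp add: U_def L)
    \<comment> \<open>Maximality of the likelihood enters here, with \<open>X\<close> itself as the
      competitor.\<close>
    moreover have "(\<Sum>i<n. log_loss (S i) (Xhat S)) \<le> (\<Sum>i<n. log_loss (S i) X)"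
      using mle(2)[of S X] S XT by (simp add: P_def loglik_eq_log_loss)
    ultimately show ?thesis by (simp add: V_def sum_subtractf right_diff_distrib)
  qed
  have "n * measure_pmf.expectation P (\<lambda>S. L (Xhat S) - L X) = measure_pmf.expectation P (\<lambda>S. n * (L (Xhat S) - L X))"
    by simp
  also have "\<dots> \<le> measure_pmf.expectation P (\<lambda>S. U S + V S)"
    by (rule expectation_mono_finite_pmf[OF finP pt])
  also have "\<dots> = measure_pmf.expectation P U" using EV by (simp add: int)
  also note EU
  finally have "measure_pmf.expectation P (\<lambda>S. L (Xhat S) - L X) \<le> 24 * B * sqrt (real (m1 + m2) * real n) / n"
    using n by (simp add: field_simps)
  also have "\<dots> = 24 * B * sqrt (real (m1 + m2) / n)"
  proof -
    have "sqrt (real (m1 + m2) * real n) / n = sqrt (real (m1 + m2)) * (sqrt n / n)"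
      by (simp add: real_sqrt_mult)
    also have "sqrt n / n = 1 / sqrt n" using n by (simp add: field_simps)
    finally have "sqrt (real (m1 + m2) * real n) / n = sqrt (real (m1 + m2) / n)" by (simp add: real_sqrt_divide)
    then show ?thesis by (simp only: times_divide_eq_right[symmetric])
  qed
  finally show ?thesis by (simp add: P_def)
qed

theorem theorem1:
  fixes \<gamma> :: real
  assumes "\<gamma> > 0"
  shows "\<exists>C > 0. \<forall>(m1::nat) (m2::nat) (n::nat) (X::real mat)
            (Xhat :: (nat \<Rightarrow> bool \<times> (nat \<times> nat)) \<Rightarrow> real mat).
    m1 \<ge> 1 \<longrightarrow> m2 \<ge> 1 \<longrightarrow> n \<ge> 1 \<longrightarrow>
    X \<in> carrier_mat m1 m2 \<longrightarrow> sup_norm X \<le> \<gamma> \<longrightarrow>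
    (\<forall>S \<in> set_pmf (sample_pmf n X).
        Xhat S \<in> K_max m1 m2 \<gamma> (real (vec_space.rank m1 X)) \<and>
        (\<forall>Z \<in> K_max m1 m2 \<gamma> (real (vec_space.rank m1 X)). loglik n S Z \<le> loglik n S (Xhat S))) \<longrightarrow>
    excess_risk n X Xhat
      \<le> sqrt (C * sqrt (real (vec_space.rank m1 X) * real (m1 + m2) / real n))"
proof (rule exI[of _ "48 * \<gamma>"], intro conjI allI impI)
  fix m1 m2 n :: nat and X :: "real mat" and Xhat :: "(nat \<Rightarrow> bool \<times> (nat \<times> nat)) \<Rightarrow> real mat"
  assume m: "m1 \<ge> 1" "m2 \<ge> 1" and n: "n \<ge> 1" and X: "X \<in> carrier_mat m1 m2" and sup: "sup_norm X \<le> \<gamma>"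
    and mle: "\<forall>S \<in> set_pmf (sample_pmf n X).
        Xhat S \<in> K_max m1 m2 \<gamma> (real (vec_space.rank m1 X)) \<and>
        (\<forall>Z \<in> K_max m1 m2 \<gamma> (real (vec_space.rank m1 X)). loglik n S Z \<le> loglik n S (Xhat S))"
  define r where "r = real (vec_space.rank m1 X)"
  define L where "L Z = measure_pmf.expectation (draw_pmf X) (\<lambda>s. log_loss s Z)" for Z
  define D where "D = 24 * \<gamma> * sqrt (r * real (m1 + m2) / n)"
  let ?P = "sample_pmf n X"
  have D0: "D \<ge> 0" using assms by (simp add: D_def r_def)
  have XK: "X \<in> K_max m1 m2 \<gamma> r"
    using max_norm_le_sqrt_rank[OF X m sup] X sup assms by (simp add: K_max_def r_def)
  have "measure_pmf.expectation ?P (\<lambda>S. L (Xhat S) - L X) \<le> 24 * (\<gamma> * sqrt r) * sqrt (real (m1 + m2) / n)"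
    unfolding L_def
  proof (rule expected_log_loss_excess_le[OF X m n, of _ "K_max m1 m2 \<gamma> r" \<gamma>])
    show "\<gamma> * sqrt r \<ge> 0" using assms by (simp add: r_def)
  qed (use mle XK in \<open>auto simp: r_def[symmetric], auto simp: K_max_def\<close>)
  also have "\<dots> = D" by (simp add: D_def real_sqrt_mult[symmetric])
  finally have ED: "measure_pmf.expectation ?P (\<lambda>S. L (Xhat S) - L X) \<le> D" .
  have "finite (set_pmf (draw_pmf X))" by (rule finite_subset[OF set_draw_pmf[OF X m]]) auto
  then have finP: "finite (set_pmf ?P)" unfolding sample_pmf_def
    by (intro finite_subset[OF set_Pi_pmf_subset']) (auto intro!: finite_PiE_dflt)
  have int: "integrable ?P f" for f :: "_ \<Rightarrow> real" using finP by (rule integrable_measure_pmf_finite)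
  have bound: "excess_risk n X Xhat \<le> D / t + t / 2" if t: "t > 0" for t
  proof -
    have "excess_risk n X Xhat = measure_pmf.expectation ?P (\<lambda>S. risk X (plugin (Xhat S)) - risk X (plugin X))"
      by (simp add: excess_risk_def int)
    also have "\<dots> \<le> measure_pmf.expectation ?P (\<lambda>S. (L (Xhat S) - L X) / t + t / 2)"
      unfolding L_def using finP X m t by (intro expectation_mono_finite_pmf risk_excess_le)
    also have "\<dots> = measure_pmf.expectation ?P (\<lambda>S. L (Xhat S) - L X) / t + t / 2"
      by (simp add: int)
    also have "\<dots> \<le> D / t + t / 2" using ED t by (simp add: divide_right_mono)
    finally show ?thesis .
  qed
  have "excess_risk n X Xhat \<le> sqrt (2 * D)"
  proof (cases "D = 0")
    \<comment> \<open>This is the rank 0 case: no positive \<open>t\<close> is optimal, so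
      \<open>t\<close> is sent to 0.\<close>
    case True
    have "excess_risk n X Xhat \<le> 0 + e" if "e > 0" for e using bound[of "2 * e"] that True by simp
    then have "excess_risk n X Xhat \<le> 0" by (rule field_le_epsilon)
    then show ?thesis using True by simp
  next
    case False
    then have pos: "sqrt (2 * D) > 0" using D0 by simp
    \<comment> \<open>The choice \<open>t = sqrt (2 * D)\<close> minimises
      \<open>D / t + t / 2\<close> by making both terms equal; the resulting \<open>2 * D\<close>
      turns 24 into 48.\<close>
    have "D / sqrt (2 * D) = sqrt (2 * D) / 2"
      using pos D0 by (simp add: field_simps flip: power2_eq_square)
    then show ?thesis using bound[OF pos] by simp
  qed
  also have "2 * D = 48 * \<gamma> * sqrt (real (vec_space.rank m1 X) * real (m1 + m2) / real n)"
    by (simp add: D_def r_def)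
  finally show "excess_risk n X Xhat \<le>
    sqrt (48 * \<gamma> * sqrt (real (vec_space.rank m1 X) * real (m1 + m2) / real n))" .
qed (use assms in simp)

end
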